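(* Let $(G_n)_n$ be a sequence of finite simple graphs, where $G_n$ has exactly $n$ vertices, which is convergent in the dense model, i.e. for every fixed finite simple graph $F$ the sequence $\hom(F,G_n)/n^{v(F)}$ converges. Then for every real $C>8$, the quantity $$\frac{\sqrt[n]{P(G_n,Cn)}}{n}$$ converges as $n\to\infty$.
   Context: $\hom(F,G)$ is the number of graph homomorphisms from $F$ to $G$ and $v(F)$ is the number of vertices of $F$. The chromatic polynomial of a graph $G$ on $n$ vertices is $P(G,x)=\sum_{k=0}^n \mathrm{ip}(G,k)\,x(x-1)\cdots(x-k+1)$, where $\mathrm{ip}(G,k)$ is the number of partitions of $V(G)$ into $k$ nonempty independent sets. (For real $x>n-1$ every summand is nonnegative and the $k=n$ summand is positive, so $P(G_n,Cn)>0$ and the positive real $n$-th root is meant.) *)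

theory Defs
  imports
    "HOL-Analysis.Analysis"
    "HOL-Library.Disjoint_Sets"
    "Graph_Theory.Pair_Digraph"
begin

text \<open>
  Finite simple graphs are the \<^locale>\<open>pair_graph\<close> structures: finite vertex set, loop-free
  symmetric set of vertex pairs.
\<close>

text \<open>
  Homomorphisms are taken extensional on the vertex set (\<open>\<rightarrow>\<^sub>E\<close>), so that each map between the
  vertex sets is counted once.
\<close>

definition hom_count :: "'a pair_pre_digraph \<Rightarrow> 'b pair_pre_digraph \<Rightarrow> nat" where
  "hom_count F G =
     card {f \<in> pverts F \<rightarrow>\<^sub>E pverts G. \<forall>(u, v) \<in> parcs F. (f u, f v) \<in> parcs G}"

definition hom_density :: "'a pair_pre_digraph \<Rightarrow> 'b pair_pre_digraph \<Rightarrow> real" where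
  "hom_density F G = real (hom_count F G) / real (card (pverts G)) ^ card (pverts F)"

text \<open>
  Every finite graph is isomorphic to one with vertices in \<^typ>\<open>nat\<close>, so test graphs of that
  type are all that is needed.
\<close>

definition dense_convergent :: "(nat \<Rightarrow> 'a pair_pre_digraph) \<Rightarrow> bool" where
  "dense_convergent G \<longleftrightarrow>
     (\<forall>F :: nat pair_pre_digraph. pair_graph F \<longrightarrow> convergent (\<lambda>n. hom_density F (G n)))"

definition independent_set :: "'a pair_pre_digraph \<Rightarrow> 'a set \<Rightarrow> bool" where
  "independent_set G A \<longleftrightarrow> A \<subseteq> pverts G \<and> (\<forall>u \<in> A. \<forall>v \<in> A. (u, v) \<notin> parcs G)"

definition ip :: "'a pair_pre_digraph \<Rightarrow> nat \<Rightarrow> nat" where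
  "ip G k =
     card {\<P>. partition_on (pverts G) \<P> \<and> card \<P> = k \<and> (\<forall>A \<in> \<P>. independent_set G A)}"

definition chromatic_poly :: "'a pair_pre_digraph \<Rightarrow> real \<Rightarrow> real" where
  "chromatic_poly G x =
     (\<Sum>k = 0..card (pverts G). real (ip G k) * (\<Prod>i<k. x - real i))"

end

theory Submission
  imports Defs
begin

text \<open>
  Everything rests on one recursion for the chromatic polynomials \<open>P\<^sub>U\<close> of the induced subgraphs:
  splitting off the colour class of a vertex \<open>x\<close> gives
  \<open>P\<^sub>U(q) = q \<Sum>\<^sub>T P\<^bsub>U - T\<^esub>(q - 1)\<close>, the sum being over the stable sets \<open>T\<close> containing \<open>x\<close>. It implies
  the binomial identity \<open>P\<^sub>U(q + r) = \<Sum>\<^sub>S P\<^sub>S(r) P\<^bsub>U - S\<^esub>(q)\<close>, and with \<open>\<phi>(S)\<close> the linear coefficient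
  of \<open>P\<^sub>S\<close> the polymer expansion \<open>P\<^sub>U(q) = q \<Sum>\<^sub>S \<phi>(S) P\<^bsub>U - S\<^esub>(q)\<close> over the sets \<open>S\<close> containing \<open>x\<close>.

  In the variable \<open>z = 1/q\<close> the latter is a system of Kirkwood-Salsburg equations for the formal power
  series \<open>\<rho>(X)\<close> of \<open>q\<^bsup>|X|\<^esup> P\<^bsub>U - X\<^esub>(q) / P\<^sub>U(q)\<close>. Because \<open>|\<phi>(S)| \<le> (|S| - 1)!\<close>, a majorant argument
  bounds \<open>\<rho>(X)\<close> at radius \<open>1/(6n)\<close>, so the logarithm of \<open>P\<^sub>U(q)/q\<^sup>n\<close> is given by an absolutely
  convergent series for \<open>q > 6n\<close>. No information on complex chromatic roots is needed.

  The same equations show that the \<open>k\<close>-th coefficient of the logarithm is a sum of contributions of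
  vertex sets of size at most \<open>k + 1\<close>, each depending only on the isomorphism type of the induced
  subgraph. Divided by \<open>n\<^bsup>k+1\<^esup>\<close> it therefore converges along a dense convergent sequence, and
  Tannery's theorem exchanges the limit with the summation over \<open>k\<close>.
\<close>

section \<open>Sums over subsets\<close>

lemma sum_Pow_insert:
  fixes f :: "'a set \<Rightarrow> 'b::comm_monoid_add"
  assumes "finite M" "x \<notin> M"
  shows "(\<Sum>S\<in>Pow (insert x M). f S) = (\<Sum>S\<in>Pow M. f S) + (\<Sum>S\<in>Pow M. f (insert x S))"
proof -
  have "inj_on (insert x) (Pow M)"
    using assms(2) by (auto simp: inj_on_def)
  then have "(\<Sum>S\<in>insert x ` Pow M. f S) = (\<Sum>S\<in>Pow M. f (insert x S))"
    by (simp add: sum.reindex)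
  moreover have "Pow M \<inter> insert x ` Pow M = {}"
    using assms(2) by auto
  ultimately show ?thesis
    using assms(1) by (simp add: Pow_insert sum.union_disjoint)
qed

text \<open>A disjoint pair \<open>(A, B)\<close> is the same as a set
  \<open>S = A \<union> B\<close> with a chosen subset \<open>A\<close>. Convolutions over subsets
  are reassociated this way.\<close>

lemma sum_Pow_Diff_regroup:
  fixes f :: "'a set \<Rightarrow> 'a set \<Rightarrow> 'b::comm_monoid_add"
  assumes "finite M"
  shows "(\<Sum>A\<in>Pow M. \<Sum>B\<in>Pow (M - A). f A B) = (\<Sum>S\<in>Pow M. \<Sum>A\<in>Pow S. f A (S - A))"
proof -
  have "(\<Sum>A\<in>Pow M. \<Sum>B\<in>Pow (M - A). f A B)
      = (\<Sum>(A, B)\<in>(SIGMA A:Pow M. Pow (M - A)). f A B)"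
    using assms by (subst sum.Sigma) auto
  also have "\<dots> = (\<Sum>(S, A)\<in>(SIGMA S:Pow M. Pow S). f A (S - A))"
    by (rule sum.reindex_bij_witness[of _ "\<lambda>(S, A). (A, S - A)" "\<lambda>(A, B). (A \<union> B, A)"])
      (auto intro: arg_cong2[where f=f])
  also have "\<dots> = (\<Sum>S\<in>Pow M. \<Sum>A\<in>Pow S. f A (S - A))"
    using assms by (subst sum.Sigma) (auto intro: finite_subset)
  finally show ?thesis .
qed

lemma sum_Pow_Diff_swap:
  fixes f :: "'a set \<Rightarrow> 'a set \<Rightarrow> 'b::comm_monoid_add"
  assumes "finite M"
  shows "(\<Sum>A\<in>Pow M. \<Sum>B\<in>Pow (M - A). f A B) = (\<Sum>B\<in>Pow M. \<Sum>A\<in>Pow (M - B). f A B)"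
proof -
  have "(\<Sum>A\<in>Pow M. \<Sum>B\<in>Pow (M - A). f A B)
      = (\<Sum>(A, B)\<in>(SIGMA A:Pow M. Pow (M - A)). f A B)"
    using assms by (subst sum.Sigma) auto
  also have "\<dots> = (\<Sum>(B, A)\<in>(SIGMA B:Pow M. Pow (M - B)). f A B)"
    by (rule sum.reindex_bij_witness[of _ "\<lambda>(B, A). (A, B)" "\<lambda>(A, B). (B, A)"]) auto
  also have "\<dots> = (\<Sum>B\<in>Pow M. \<Sum>A\<in>Pow (M - B). f A B)"
    using assms by (subst sum.Sigma) auto
  finally show ?thesis .
qed

lemma sum_Pow_by_card:
  fixes f :: "'a set \<Rightarrow> 'b::comm_monoid_add"
  assumes "finite M"
  shows "(\<Sum>S\<in>Pow M. f S) = (\<Sum>j\<le>card M. \<Sum>S | S \<subseteq> M \<and> card S = j. f S)"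
proof -
  have "(\<Sum>j\<le>card M. \<Sum>S | S \<in> Pow M \<and> card S = j. f S) = (\<Sum>S\<in>Pow M. f S)"
    using assms by (intro sum.group) (auto intro: card_mono)
  then show ?thesis by simp
qed

lemma sum_Pow_card:
  fixes g :: "nat \<Rightarrow> real"
  assumes "finite M"
  shows "(\<Sum>S\<in>Pow M. g (card S)) = (\<Sum>j\<le>card M. real (card M choose j) * g j)"
proof -
  have "(\<Sum>S | S \<subseteq> M \<and> card S = j. g (card S)) = real (card M choose j) * g j" for j
    using n_subsets[OF assms, of j] by simp
  then show ?thesis unfolding sum_Pow_by_card[OF assms] by (rule sum.cong[OF refl])
qed

section \<open>Chromatic polynomials of induced subgraphs\<close>

definition stable_set :: "'a rel \<Rightarrow> 'a set \<Rightarrow> bool" where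
  "stable_set E A \<longleftrightarrow> (\<forall>u\<in>A. \<forall>v\<in>A. (u, v) \<notin> E)"

definition stable_partitions :: "'a rel \<Rightarrow> 'a set \<Rightarrow> nat \<Rightarrow> 'a set set set" where
  "stable_partitions E U k = {P. partition_on U P \<and> card P = k \<and> (\<forall>A\<in>P. stable_set E A)}"

text \<open>The relation \<open>E\<close> stays fixed while the vertex set varies, so induced
  subgraphs need no graphs of their own. A formal polynomial gives access to linear and leading
  coefficients and to the derivative.\<close>

definition chrom :: "'a rel \<Rightarrow> 'a set \<Rightarrow> real poly" where
  "chrom E U = (\<Sum>k\<le>card U. smult (real (card (stable_partitions E U k))) (\<Prod>i<k. [:- real i, 1:]))"

lemma finite_stable_partitions: "finite U \<Longrightarrow> finite (stable_partitions E U k)"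
  unfolding stable_partitions_def using finitely_many_partition_on by (rule finite_subset[rotated]) auto

lemma stable_partitions_eq_empty:
  assumes "finite U" "card U < k"
  shows "stable_partitions E U k = {}"
proof -
  have "card P \<le> card U" if "partition_on U P" for P
  proof -
    have "\<forall>A\<in>P. \<exists>a. a \<in> A"
      using partition_onD3[OF that] by (metis ex_in_conv)
    then obtain f where f: "\<And>A. A \<in> P \<Longrightarrow> f A \<in> A" by metis
    have "inj_on f P"
    proof (rule inj_onI)
      fix A B assume "A \<in> P" "B \<in> P" "f A = f B"
      then have "\<not> disjnt A B" using f[of A] f[of B] by (auto simp: disjnt_def)
      then show "A = B"
        using partition_onD2[OF that] \<open>A \<in> P\<close> \<open>B \<in> P\<close> by (auto dest: pairwiseD)
    qed
    moreover have "f ` P \<subseteq> U"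
      using f partition_onD1[OF that] by auto
    ultimately show ?thesis
      using assms(1) card_inj_on_le by blast
  qed
  then have "card P \<noteq> k" if "partition_on U P" for P
    using that assms(2) leD by blast
  then show ?thesis
    by (auto simp: stable_partitions_def)
qed

text \<open>The partition counts vanish beyond \<open>card U\<close>, so one bound \<open>N\<close>
  serves all subsets at once and the sums over \<open>k\<close> and over vertex sets can be
  exchanged.\<close>

lemma poly_chrom:
  assumes "finite U" "card U \<le> N"
  shows "poly (chrom E U) q = (\<Sum>k\<le>N. real (card (stable_partitions E U k)) * (\<Prod>i<k. q - real i))"
proof -
  have "poly (chrom E U) q = (\<Sum>k\<le>card U. real (card (stable_partitions E U k)) * (\<Prod>i<k. q - real i))"
    by (simp add: chrom_def poly_sum poly_prod)
  also have "\<dots> = (\<Sum>k\<le>N. real (card (stable_partitions E U k)) * (\<Prod>i<k. q - real i))"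
    using assms by (intro sum.mono_neutral_left) (auto simp: stable_partitions_eq_empty)
  finally show ?thesis .
qed

lemma chrom_empty [simp]: "chrom E {} = 1"
proof -
  have "stable_partitions E {} 0 = {{}}"
    by (auto simp: stable_partitions_def partition_on_empty)
  then show ?thesis by (simp add: chrom_def)
qed

text \<open>Deleting the part \<open>insert x W\<close> of \<open>x\<close> leaves a stable
  partition of \<open>M - W\<close> with one part fewer, and this can be undone.\<close>

lemma stable_partitions_insert_eq:
  assumes "finite M" "x \<notin> M"
  shows "stable_partitions E (insert x M) (Suc k)
    = (\<Union>W\<in>{W\<in>Pow M. stable_set E (insert x W)}. insert (insert x W) ` stable_partitions E (M - W) k)"
    (is "?L = ?R")
proof (intro equalityI subsetI)
  fix P assume "P \<in> ?L"
  then have P: "partition_on (insert x M) P" "card P = Suc k" "\<forall>A\<in>P. stable_set E A"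
    by (auto simp: stable_partitions_def)
  then obtain T where T: "T \<in> P" "x \<in> T"
    using partition_onD1[OF P(1)] by auto
  define W where "W = T - {x}"
  have T_eq: "T = insert x W" "x \<notin> W" using T by (auto simp: W_def)
  have "W \<subseteq> M"
    using T partition_onD1[OF P(1)] by (auto simp: W_def)
  have finP: "finite P" using P(2) card.infinite by fastforce
  have disj: "disjoint P" using partition_onD2[OF P(1)] .
  have "\<Union>(P - {T}) = M - W"
  proof -
    have "A \<inter> T = {}" if "A \<in> P" "A \<noteq> T" for A
      using that T(1) disj by (auto simp: disjoint_def)
    then have "\<Union>(P - {T}) = \<Union>P - T" by blast
    also have "\<dots> = M - W"
      using partition_onD1[OF P(1)] T_eq assms(2) by auto
    finally show ?thesis .
  qed
  then have "partition_on (M - W) (P - {T})"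
    using P(1) by (auto simp: partition_on_def intro: pairwise_subset)
  moreover have "card (P - {T}) = k" using T(1) finP P(2) by simp
  ultimately have "P - {T} \<in> stable_partitions E (M - W) k"
    using P(3) by (auto simp: stable_partitions_def)
  moreover have "P = insert (insert x W) (P - {T})" using T(1) T_eq(1) by blast
  moreover have "stable_set E (insert x W)" using P(3) T(1) T_eq(1) by auto
  ultimately show "P \<in> ?R" using \<open>W \<subseteq> M\<close> by blast
next
  fix P assume "P \<in> ?R"
  then obtain W Q where W: "W \<subseteq> M" "stable_set E (insert x W)"
    and Q: "Q \<in> stable_partitions E (M - W) k" and P: "P = insert (insert x W) Q"
    by auto
  have Qp: "partition_on (M - W) Q" "card Q = k" "\<forall>A\<in>Q. stable_set E A"
    using Q by (auto simp: stable_partitions_def)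
  have un: "\<Union>Q = M - W" using partition_onD1[OF Qp(1)] by simp
  have "insert x W \<notin> Q" using un assms(2) by auto
  moreover have "finite Q" using finite_elements[OF _ Qp(1)] assms(1) by simp
  ultimately have "card P = Suc k" using P Qp(2) by simp
  moreover have "partition_on (insert x M) P"
  proof (rule partition_onI)
    show "\<Union>P = insert x M" using P un W(1) by auto
    show "{} \<notin> P" using P partition_onD3[OF Qp(1)] by auto
    fix A B assume AB: "A \<in> P" "B \<in> P" "A \<noteq> B"
    have new: "disjnt C (insert x W)" if "C \<in> Q" for C
      using that un assms(2) by (auto simp: disjnt_def)
    show "disjnt A B"
    proof (cases "A \<in> Q \<and> B \<in> Q")
      case True
      then show ?thesis using AB(3) partition_onD2[OF Qp(1)] by (auto dest: pairwiseD)
    next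
      case False
      then show ?thesis using AB P new by (metis disjnt_sym insert_iff)
    qed
  qed
  ultimately show "P \<in> ?L"
    using W(2) Qp(3) P by (auto simp: stable_partitions_def)
qed

lemma card_stable_partitions_insert:
  assumes "finite M" "x \<notin> M"
  shows "card (stable_partitions E (insert x M) (Suc k))
    = (\<Sum>W\<in>Pow M. of_bool (stable_set E (insert x W)) * card (stable_partitions E (M - W) k))"
proof -
  have notin: "insert x W \<notin> Q" if "Q \<in> stable_partitions E (M - W) k" for W Q
    using that partition_onD1[of "M - W" Q] assms(2) by (auto simp: stable_partitions_def)
  have "card (stable_partitions E (insert x M) (Suc k))
    = (\<Sum>W\<in>{W\<in>Pow M. stable_set E (insert x W)}. card (insert (insert x W) ` stable_partitions E (M - W) k))"
    unfolding stable_partitions_insert_eq[OF assms]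
  proof (intro card_UN_disjoint ballI impI)
    fix W W' assume W: "W \<in> {W\<in>Pow M. stable_set E (insert x W)}" "W' \<in> {W\<in>Pow M. stable_set E (insert x W)}" "W \<noteq> W'"
    show "insert (insert x W) ` stable_partitions E (M - W) k \<inter>
          insert (insert x W') ` stable_partitions E (M - W') k = {}"
    proof (rule ccontr)
      assume "\<not> ?thesis"
      then obtain Q Q' where Q: "Q \<in> stable_partitions E (M - W) k" "Q' \<in> stable_partitions E (M - W') k"
        "insert (insert x W) Q = insert (insert x W') Q'" by blast
      have "insert x W \<noteq> insert x W'" using W assms(2) by auto
      then have "insert x W \<in> Q'" using Q(3) by blast
      then show False
        using Q(2) partition_onD1[of "M - W'" Q'] assms(2) by (auto simp: stable_partitions_def)
    qed
  qed (use assms(1) in \<open>auto intro: finite_stable_partitions\<close>)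
  also have "\<dots> = (\<Sum>W\<in>{W\<in>Pow M. stable_set E (insert x W)}. card (stable_partitions E (M - W) k))"
  proof (intro sum.cong refl card_image inj_onI)
    fix W P Q assume "P \<in> stable_partitions E (M - W) k" "Q \<in> stable_partitions E (M - W) k"
      "insert (insert x W) P = insert (insert x W) Q"
    then show "P = Q" using insert_ident[OF notin notin] by blast
  qed
  also have "\<dots> = (\<Sum>W\<in>Pow M. of_bool (stable_set E (insert x W)) * card (stable_partitions E (M - W) k))"
    using assms(1) by (intro sum.mono_neutral_cong_left) auto
  finally show ?thesis .
qed

definition stable_ind :: "'a rel \<Rightarrow> 'a set \<Rightarrow> real" where
  "stable_ind E A = of_bool (stable_set E A)"

text \<open>The colour class of \<open>x\<close> gets one of \<open>q\<close> colours, the rest is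
  coloured with the other \<open>q - 1\<close>. Working with partitions and falling factorials makes
  this valid for every real \<open>q\<close>.\<close>

lemma poly_chrom_insert:
  assumes "finite M" "x \<notin> M"
  shows "poly (chrom E (insert x M)) q
    = q * (\<Sum>W\<in>Pow M. stable_ind E (insert x W) * poly (chrom E (M - W)) (q - 1))"
proof -
  let ?N = "card M"
  have 0: "stable_partitions E (insert x M) 0 = {}"
  proof -
    have "card P \<noteq> 0" if "partition_on (insert x M) P" for P
      using finite_elements[OF _ that] partition_onD1[OF that] assms(1)
      by (metis Union_empty card_0_eq finite_insert insert_not_empty)
    then show ?thesis by (auto simp: stable_partitions_def)
  qed
  have shift: "(\<Prod>i<Suc k. q - real i) = q * (\<Prod>i<k. q - 1 - real i)" for k
    by (subst prod.lessThan_Suc_shift) (simp add: algebra_simps)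
  have "poly (chrom E (insert x M)) q
      = (\<Sum>k\<le>Suc ?N. real (card (stable_partitions E (insert x M) k)) * (\<Prod>i<k. q - real i))"
    using assms by (intro poly_chrom) auto
  also have "\<dots> = (\<Sum>k\<le>?N. real (card (stable_partitions E (insert x M) (Suc k))) * (q * (\<Prod>i<k. q - 1 - real i)))"
    by (simp add: sum.atMost_Suc_shift 0 shift del: sum.atMost_Suc prod.lessThan_Suc)
  also have "\<dots> = (\<Sum>k\<le>?N. \<Sum>W\<in>Pow M. q * (stable_ind E (insert x W) *
      (real (card (stable_partitions E (M - W) k)) * (\<Prod>i<k. q - 1 - real i))))"
    by (simp add: card_stable_partitions_insert[OF assms] stable_ind_def sum_distrib_right sum_distrib_left mult_ac)
  also have "\<dots> = (\<Sum>W\<in>Pow M. q * (stable_ind E (insert x W) * poly (chrom E (M - W)) (q - 1)))"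
    using assms(1) by (subst sum.swap) (simp add: poly_chrom[where N = ?N] card_mono flip: sum_distrib_left)
  finally show ?thesis by (simp add: sum_distrib_left)
qed

text \<open>\<open>S\<close> is the set of vertices coloured from the \<open>r\<close> extra
  colours. For real arguments the identity follows by induction from the recursion, applied to the
  factor that holds the vertex \<open>x\<close>.\<close>

lemma poly_chrom_add:
  assumes "finite M"
  shows "poly (chrom E M) (q + r) = (\<Sum>S\<in>Pow M. poly (chrom E S) r * poly (chrom E (M - S)) q)"
  using assms
proof (induction "card M" arbitrary: M q r rule: less_induct)
  case less
  show ?case
  proof (cases "M = {}")
    case False
    then obtain x N where xN: "M = insert x N" "x \<notin> N" by (metis Set.set_insert ex_in_conv)
    have fin: "finite N" using less.prems xN by simp
    let ?I = "\<lambda>W. stable_ind E (insert x W)"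
    let ?P = "\<lambda>U. poly (chrom E U)"
    have Diff_right_commute: "A - S - W = A - W - S" for A S W :: "'a set" by auto
    have IH: "(\<Sum>S\<in>Pow (N - W). ?P S r * ?P (N - W - S) q) = ?P (N - W) (q + r)" for W q r
    proof -
      have "card (N - W) < card M" using fin xN by (simp add: card_mono less_Suc_eq_le)
      then show ?thesis using less.hyps[of "N - W" q r] fin by simp
    qed
    \<comment> \<open>Case \<open>x \<notin> S\<close>: the recursion unfolds the factor at
      \<open>q\<close>, and the induction hypothesis on \<open>N - W\<close> merges the values at
      \<open>r\<close> and \<open>q - 1\<close>.\<close>
    have 1: "(\<Sum>S\<in>Pow N. ?P S r * ?P (insert x N - S) q) = q * (\<Sum>W\<in>Pow N. ?I W * ?P (N - W) (q + r - 1))"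
    proof -
      have "(\<Sum>S\<in>Pow N. ?P S r * ?P (insert x N - S) q)
          = (\<Sum>S\<in>Pow N. ?P S r * (q * (\<Sum>W\<in>Pow (N - S). ?I W * ?P (N - S - W) (q - 1))))"
      proof (intro sum.cong refl)
        fix S assume "S \<in> Pow N"
        then have "insert x N - S = insert x (N - S)" using xN(2) by auto
        then show "?P S r * ?P (insert x N - S) q = ?P S r * (q * (\<Sum>W\<in>Pow (N - S). ?I W * ?P (N - S - W) (q - 1)))"
          using poly_chrom_insert[of "N - S" x E q] fin xN(2) by simp
      qed
      also have "\<dots> = (\<Sum>S\<in>Pow N. \<Sum>W\<in>Pow (N - S). q * (?I W * (?P S r * ?P (N - W - S) (q - 1))))"
        by (simp add: sum_distrib_left mult.left_commute Diff_right_commute[of N])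
      also have "\<dots> = (\<Sum>W\<in>Pow N. \<Sum>S\<in>Pow (N - W). q * (?I W * (?P S r * ?P (N - W - S) (q - 1))))"
        by (rule sum_Pow_Diff_swap[OF fin])
      also have "\<dots> = (\<Sum>W\<in>Pow N. q * (?I W * ?P (N - W) (q + r - 1)))"
        using IH[where r = r and q = "q - 1"] by (simp add: diff_add_eq flip: sum_distrib_left)
      finally show ?thesis by (simp add: sum_distrib_left)
    qed
    \<comment> \<open>Case \<open>x \<in> S\<close>: the factor at \<open>r\<close> is unfolded
      instead. The same sum appears with factor \<open>r\<close>, so the two cases add up to
      \<open>q + r\<close>.\<close>
    have 2: "(\<Sum>S\<in>Pow N. ?P (insert x S) r * ?P (insert x N - insert x S) q)
      = r * (\<Sum>W\<in>Pow N. ?I W * ?P (N - W) (q + r - 1))"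
    proof -
      have "(\<Sum>S\<in>Pow N. ?P (insert x S) r * ?P (insert x N - insert x S) q)
          = (\<Sum>S\<in>Pow N. \<Sum>W\<in>Pow S. r * (?I W * (?P (S - W) (r - 1) * ?P (N - W - (S - W)) q)))"
      proof (intro sum.cong refl)
        fix S assume S: "S \<in> Pow N"
        then have eq: "insert x N - insert x S = N - S" "finite S" "x \<notin> S"
          using xN(2) fin finite_subset by auto
        have "N - W - (S - W) = N - S" if "W \<in> Pow S" for W
          using that by auto
        then show "?P (insert x S) r * ?P (insert x N - insert x S) q
          = (\<Sum>W\<in>Pow S. r * (?I W * (?P (S - W) (r - 1) * ?P (N - W - (S - W)) q)))"
          using poly_chrom_insert[of S x E r] eq by (simp add: sum_distrib_left sum_distrib_right mult_ac)
      qed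
      also have "\<dots> = (\<Sum>W\<in>Pow N. \<Sum>B\<in>Pow (N - W). r * (?I W * (?P B (r - 1) * ?P (N - W - B) q)))"
        by (rule sum_Pow_Diff_regroup[OF fin, symmetric])
      also have "\<dots> = (\<Sum>W\<in>Pow N. r * (?I W * ?P (N - W) (q + r - 1)))"
        using IH[where r = "r - 1" and q = q] by (simp add: add_diff_eq flip: sum_distrib_left)
      finally show ?thesis by (simp add: sum_distrib_left)
    qed
    have "(\<Sum>S\<in>Pow M. ?P S r * ?P (M - S) q) = (q + r) * (\<Sum>W\<in>Pow N. ?I W * ?P (N - W) (q + r - 1))"
      unfolding xN(1) sum_Pow_insert[OF fin xN(2)] 1 2 by (simp add: algebra_simps)
    also have "\<dots> = ?P M (q + r)"
      unfolding xN(1) using poly_chrom_insert[OF fin xN(2)] by simp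
    finally show ?thesis by simp
  qed simp
qed

lemma poly_eqI_all:
  fixes p q :: "real poly"
  shows "(\<And>x. poly p x = poly q x) \<Longrightarrow> p = q"
  by (rule poly_eq_poly_eq_iff[THEN iffD1], rule ext)

section \<open>The polymer expansion\<close>

text \<open>
  This is the sum of \<open>(-1)\<^bsup>|A|\<^esup>\<close> over the edge sets \<open>A\<close> that connect \<open>S\<close>, the Ursell function of the
  cluster expansion.
\<close>

definition ursell :: "'a rel \<Rightarrow> 'a set \<Rightarrow> real" where
  "ursell E S = coeff (chrom E S) 1"

lemma ursell_empty [simp]: "ursell E {} = 0"
  by (simp add: ursell_def)

lemma chrom_insert:
  assumes "finite M" "x \<notin> M"
  shows "chrom E (insert x M)
    = pCons 0 (\<Sum>W\<in>Pow M. smult (stable_ind E (insert x W)) (pcompose (chrom E (M - W)) [:-1, 1:]))"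
  by (rule poly_eqI_all) (simp add: poly_chrom_insert[OF assms] poly_sum poly_pcompose)

text \<open>Dividing the recursion by \<open>q\<close> and setting \<open>q = 0\<close> yields the
  linear coefficient; the argument \<open>q - 1\<close> becomes \<open>-1\<close>.\<close>

lemma ursell_insert:
  assumes "finite M" "x \<notin> M"
  shows "ursell E (insert x M) = (\<Sum>W\<in>Pow M. stable_ind E (insert x W) * poly (chrom E (M - W)) (-1))"
proof -
  have "coeff (pCons 0 g) 1 = poly g 0" for g :: "real poly"
    by (simp add: poly_0_coeff_0)
  then show ?thesis
    unfolding ursell_def chrom_insert[OF assms] by (simp add: poly_sum poly_pcompose)
qed

lemma poly_chrom_0: "finite M \<Longrightarrow> M \<noteq> {} \<Longrightarrow> poly (chrom E M) 0 = 0"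
proof -
  assume M: "finite M" "M \<noteq> {}"
  then obtain x N where "M = insert x N" "x \<notin> N" by (metis Set.set_insert ex_in_conv)
  then show ?thesis using M(1) poly_chrom_insert[of N x E 0] by simp
qed

lemma poly_chrom_1:
  assumes "finite M"
  shows "poly (chrom E M) 1 = stable_ind E M"
proof (cases "M = {}")
  case False
  then obtain x N where xN: "M = insert x N" "x \<notin> N" by (metis Set.set_insert ex_in_conv)
  have fin: "finite N" using assms xN by simp
  have "poly (chrom E M) 1 = (\<Sum>W\<in>Pow N. stable_ind E (insert x W) * poly (chrom E (N - W)) 0)"
    unfolding xN(1) by (simp add: poly_chrom_insert[OF fin xN(2)])
  \<comment> \<open>By \<open>poly_chrom_0\<close> every term vanishes in which a vertex outside
    \<open>W\<close> is left over.\<close>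
  also have "\<dots> = (\<Sum>W\<in>{N}. stable_ind E (insert x W) * poly (chrom E (N - W)) 0)"
    using fin by (intro sum.mono_neutral_right) (auto intro!: poly_chrom_0)
  finally show ?thesis by (simp add: xN)
qed (simp add: stable_ind_def stable_set_def)

text \<open>With \<open>q - 1 = q + (-1)\<close> the binomial identity splits each term of the
  recursion; the factors at \<open>-1\<close> then add up to \<open>ursell\<close> by
  \<open>ursell_insert\<close>.\<close>

lemma poly_chrom_insert_ursell:
  assumes "finite M" "x \<notin> M"
  shows "poly (chrom E (insert x M)) q = q * (\<Sum>B\<in>Pow M. ursell E (insert x B) * poly (chrom E (M - B)) q)"
proof -
  let ?I = "\<lambda>W. stable_ind E (insert x W)"
  let ?P = "\<lambda>U. poly (chrom E U)"
  have "(\<Sum>B\<in>Pow M. ursell E (insert x B) * ?P (M - B) q)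
      = (\<Sum>B\<in>Pow M. \<Sum>W\<in>Pow B. ?I W * (?P (B - W) (-1) * ?P (M - W - (B - W)) q))"
  proof (intro sum.cong refl)
    fix B assume B: "B \<in> Pow M"
    have "M - W - (B - W) = M - B" if "W \<in> Pow B" for W
      using that by auto
    moreover have "finite B" "x \<notin> B" using B assms finite_subset by auto
    ultimately show "ursell E (insert x B) * ?P (M - B) q
        = (\<Sum>W\<in>Pow B. ?I W * (?P (B - W) (-1) * ?P (M - W - (B - W)) q))"
      by (simp add: ursell_insert sum_distrib_left sum_distrib_right mult_ac)
  qed
  also have "\<dots> = (\<Sum>W\<in>Pow M. \<Sum>S\<in>Pow (M - W). ?I W * (?P S (-1) * ?P (M - W - S) q))"
    by (rule sum_Pow_Diff_regroup[OF assms(1), symmetric])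
  also have "\<dots> = (\<Sum>W\<in>Pow M. ?I W * ?P (M - W) (q - 1))"
    using assms(1) poly_chrom_add[of _ E q "-1"] by (simp flip: sum_distrib_left)
  finally show ?thesis by (simp add: poly_chrom_insert[OF assms])
qed

lemma chrom_insert_ursell:
  assumes "finite M" "x \<notin> M"
  shows "chrom E (insert x M) = pCons 0 (\<Sum>B\<in>Pow M. smult (ursell E (insert x B)) (chrom E (M - B)))"
  by (rule poly_eqI_all) (simp add: poly_chrom_insert_ursell[OF assms] poly_sum)

text \<open>Derivative of the binomial identity in \<open>r\<close> at \<open>r = 0\<close>, where
  each \<open>poly (chrom E S) r\<close> contributes its linear coefficient.\<close>

lemma pderiv_chrom:
  assumes "finite M"
  shows "pderiv (chrom E M) = (\<Sum>S\<in>Pow M. smult (ursell E S) (chrom E (M - S)))"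
proof (rule poly_eqI_all)
  fix q
  have "((\<lambda>r. poly (chrom E M) (q + r)) has_real_derivative poly (pderiv (chrom E M)) (q + 0)) (at 0)"
    by (rule DERIV_chain2[where g = "\<lambda>r. q + r", OF poly_DERIV, THEN DERIV_cong])
      (auto intro!: derivative_eq_intros)
  moreover have "((\<lambda>r. \<Sum>S\<in>Pow M. poly (chrom E S) r * poly (chrom E (M - S)) q) has_real_derivative
      (\<Sum>S\<in>Pow M. poly (pderiv (chrom E S)) 0 * poly (chrom E (M - S)) q)) (at 0)"
    by (intro DERIV_sum DERIV_cmult_right poly_DERIV)
  ultimately have "poly (pderiv (chrom E M)) q
      = (\<Sum>S\<in>Pow M. poly (pderiv (chrom E S)) 0 * poly (chrom E (M - S)) q)"
    using poly_chrom_add[OF assms] DERIV_unique by simp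
  moreover have "poly (pderiv (chrom E S)) 0 = ursell E S" for S
    by (simp add: ursell_def poly_0_coeff_0 coeff_pderiv)
  ultimately show "poly (pderiv (chrom E M)) q = poly (\<Sum>S\<in>Pow M. smult (ursell E S) (chrom E (M - S))) q"
    by (simp add: poly_sum)
qed

text \<open>An isolated \<open>x\<close> puts no constraint on \<open>W\<close>, so the stability
  indicators are values at \<open>1\<close> and the sum is the binomial identity for
  \<open>1 + (-1) = 0\<close>.\<close>

lemma ursell_isolated:
  assumes "finite M" "x \<notin> M" "M \<noteq> {}" "(x, x) \<notin> E" "\<And>a. a \<in> M \<Longrightarrow> (x, a) \<notin> E \<and> (a, x) \<notin> E"
  shows "ursell E (insert x M) = 0"
proof -
  have "stable_ind E (insert x W) = poly (chrom E W) 1" if "W \<in> Pow M" for W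
  proof -
    have "stable_set E (insert x W) = stable_set E W"
      using that assms(4,5) unfolding stable_set_def by blast
    moreover have "finite W" using that assms(1) finite_subset by auto
    ultimately show ?thesis by (simp add: poly_chrom_1 stable_ind_def)
  qed
  then have "ursell E (insert x M) = (\<Sum>W\<in>Pow M. poly (chrom E W) 1 * poly (chrom E (M - W)) (-1))"
    by (simp add: ursell_insert[OF assms(1,2)])
  also have "\<dots> = poly (chrom E M) 0"
    using poly_chrom_add[OF assms(1), of E "-1" 1] by simp
  finally show ?thesis using poly_chrom_0[OF assms(1,3)] by simp
qed

text \<open>
  No stable set contains both \<open>x\<close> and \<open>a\<close>, so \<open>a\<close> is always among the vertices left over in
  \<open>ursell_insert\<close> and can serve as the root of a second expansion.
\<close>

lemma ursell_adjacent:
  assumes "finite M" "x \<notin> insert a M" "a \<notin> M" "(x, a) \<in> E \<or> (a, x) \<in> E"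
  shows "ursell E (insert x (insert a M)) = - (\<Sum>B\<in>Pow M. ursell E (insert a B) * ursell E (insert x (M - B)))"
proof -
  let ?I = "\<lambda>W. stable_ind E (insert x W)"
  let ?P = "\<lambda>U. poly (chrom E U)"
  have xM: "x \<notin> M" using assms(2) by simp
  have [simp]: "?I (insert a W) = 0" for W
    using assms(4) by (auto simp: stable_ind_def stable_set_def)
  have "ursell E (insert x (insert a M)) = (\<Sum>W\<in>Pow M. ?I W * ?P (insert a M - W) (-1))"
    using assms by (simp add: ursell_insert sum_Pow_insert)
  also have "\<dots> = (\<Sum>W\<in>Pow M. \<Sum>B\<in>Pow (M - W). - (ursell E (insert a B) * (?I W * ?P (M - B - W) (-1))))"
  proof (intro sum.cong refl)
    fix W assume "W \<in> Pow M"
    then have 1: "insert a M - W = insert a (M - W)" using assms(3) by auto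
    have 2: "M - W - B = M - B - W" for B by auto
    show "?I W * ?P (insert a M - W) (-1)
      = (\<Sum>B\<in>Pow (M - W). - (ursell E (insert a B) * (?I W * ?P (M - B - W) (-1))))"
      unfolding 1 using assms(1,3)
      by (subst poly_chrom_insert_ursell) (auto simp: 2 sum_distrib_left sum_negf mult_ac)
  qed
  also have "\<dots> = (\<Sum>B\<in>Pow M. \<Sum>W\<in>Pow (M - B). - (ursell E (insert a B) * (?I W * ?P (M - B - W) (-1))))"
    by (rule sum_Pow_Diff_swap[OF assms(1)])
  also have "\<dots> = (\<Sum>B\<in>Pow M. - (ursell E (insert a B) * ursell E (insert x (M - B))))"
    using assms(1) xM by (simp add: ursell_insert sum_negf flip: sum_distrib_left)
  finally show ?thesis by (simp add: sum_negf)
qed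

lemma ursell_singleton: "(x, x) \<notin> E \<Longrightarrow> ursell E {x} = 1"
  using ursell_insert[of "{}" x E] by (simp add: stable_ind_def stable_set_def)

text \<open>Induction along \<open>ursell_adjacent\<close>, with \<open>m\<close> the number of
  vertices besides \<open>x\<close> and \<open>a\<close>: the \<open>m choose j\<close> sets of size
  \<open>j\<close> contribute at most \<open>j! (m - j)!\<close> each, so every \<open>j\<close>
  yields \<open>m!\<close> and the \<open>m + 1\<close> values of \<open>j\<close> give
  \<open>(m + 1)!\<close>.\<close>

lemma abs_ursell_insert_le:
  assumes "irrefl E" "finite M" "x \<notin> M"
  shows "\<bar>ursell E (insert x M)\<bar> \<le> fact (card M)"
  using assms(2,3)
proof (induction "card M" arbitrary: M x rule: less_induct)
  case less
  have loop: "(y, y) \<notin> E" for y using assms(1) by (simp add: irrefl_def)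
  consider "M = {}" | "M \<noteq> {}" "\<And>a. a \<in> M \<Longrightarrow> (x, a) \<notin> E \<and> (a, x) \<notin> E"
    | a where "a \<in> M" "(x, a) \<in> E \<or> (a, x) \<in> E" by blast
  then show ?case
  proof cases
    case 1
    then show ?thesis by (simp add: ursell_singleton loop)
  next
    case 2
    then show ?thesis using ursell_isolated[OF less.prems 2(1) loop 2(2)] by simp
  next
    case 3
    define N where "N = M - {a}"
    have N: "M = insert a N" "a \<notin> N" "finite N" "x \<notin> insert a N"
      using 3 less.prems by (auto simp: N_def)
    let ?m = "card N"
    have "\<bar>ursell E (insert x M)\<bar> \<le> (\<Sum>B\<in>Pow N. \<bar>ursell E (insert a B) * ursell E (insert x (N - B))\<bar>)"
      unfolding N(1) ursell_adjacent[OF N(3,4,2) 3(2)] by (simp add: sum_abs)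
    also have "\<dots> \<le> (\<Sum>B\<in>Pow N. fact (card B) * fact (?m - card B))"
    proof (intro sum_mono)
      fix B assume B: "B \<in> Pow N"
      have fB: "finite B" using B N(3) finite_subset by auto
      have "card B \<le> ?m" "card (N - B) = ?m - card B" "card M = Suc ?m"
        using B N fB by (auto intro: card_mono card_Diff_subset)
      then have "\<bar>ursell E (insert a B)\<bar> \<le> fact (card B)" "\<bar>ursell E (insert x (N - B))\<bar> \<le> fact (?m - card B)"
        using less.hyps[of B a] less.hyps[of "N - B" x] fB N B by auto
      then show "\<bar>ursell E (insert a B) * ursell E (insert x (N - B))\<bar> \<le> fact (card B) * fact (?m - card B)"
        unfolding abs_mult by (intro mult_mono) auto
    qed
    also have "\<dots> = (\<Sum>j\<le>?m. real (?m choose j) * (fact j * fact (?m - j)))"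
      by (rule sum_Pow_card[OF N(3)])
    also have "\<dots> = (\<Sum>j\<le>?m. fact ?m)"
    proof (intro sum.cong refl)
      fix j assume "j \<in> {..?m}"
      then have "fact j * fact (?m - j) * (?m choose j) = fact ?m"
        by (intro binomial_fact_lemma) simp
      then have "real (fact j * fact (?m - j) * (?m choose j)) = real (fact ?m)" by (rule arg_cong)
      then show "real (?m choose j) * (fact j * fact (?m - j)) = fact ?m"
        by (simp add: mult_ac)
    qed
    also have "\<dots> = fact (card M)" using N by simp
    finally show ?thesis .
  qed
qed

section \<open>Degree and leading coefficient\<close>

lemma degree_chrom_le: "finite U \<Longrightarrow> degree (chrom E U) \<le> card U"
proof (induction "card U" arbitrary: U rule: less_induct)
  case less
  show ?case
  proof (cases "U = {}")
    case False
    then obtain x N where xN: "U = insert x N" "x \<notin> N" by (metis Set.set_insert ex_in_conv)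
    have fin: "finite N" using less.prems xN by simp
    have "degree (chrom E (N - B)) \<le> card N" for B
    proof -
      have "card (N - B) \<le> card N" using fin by (simp add: card_mono)
      then show ?thesis using less.hyps[of "N - B"] fin xN by simp
    qed
    then have "degree (\<Sum>B\<in>Pow N. smult (ursell E (insert x B)) (chrom E (N - B))) \<le> card N"
      using fin by (intro degree_sum_le) (auto intro: order.trans[OF degree_smult_le])
    then show ?thesis
      unfolding xN(1) chrom_insert_ursell[OF fin xN(2)] using fin xN(2)
      by (intro order.trans[OF degree_pCons_le]) simp
  qed simp
qed

lemma coeff_chrom_card:
  assumes "irrefl E"
  shows "finite U \<Longrightarrow> coeff (chrom E U) (card U) = 1"
proof (induction U rule: finite_induct)
  case (insert x N)
  have "coeff (chrom E (insert x N)) (card (insert x N))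
      = (\<Sum>B\<in>Pow N. ursell E (insert x B) * coeff (chrom E (N - B)) (card N))"
    using insert by (simp add: chrom_insert_ursell coeff_sum)
  \<comment> \<open>A nonempty \<open>B\<close> lowers the degree below \<open>card N\<close>, so
    only \<open>B = {}\<close> reaches the leading coefficient.\<close>
  also have "\<dots> = (\<Sum>B\<in>{{}}. ursell E (insert x B) * coeff (chrom E (N - B)) (card N))"
  proof (intro sum.mono_neutral_right ballI)
    fix B assume B: "B \<in> Pow N - {{}}"
    then have "card (N - B) < card N" using insert.hyps by (intro psubset_card_mono) auto
    then have "coeff (chrom E (N - B)) (card N) = 0"
      using degree_chrom_le[of "N - B" E] insert.hyps by (intro coeff_eq_0) simp
    then show "ursell E (insert x B) * coeff (chrom E (N - B)) (card N) = 0" by simp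
  qed (use insert in auto)
  also have "\<dots> = 1"
    using insert.IH assms by (simp add: ursell_singleton irrefl_def)
  finally show ?case .
qed simp

unbundle fps_syntax

section \<open>Kirkwood-Salsburg equations\<close>

text \<open>This is \<open>q^(-n) P(q)\<close> with \<open>n = card U\<close> as a series in
  \<open>1/q\<close>; formal series can be inverted before any convergence is known. The guard keeps
  truncated subtraction from repeating the constant coefficient of \<open>chrom\<close>.\<close>

definition rev_chrom :: "'a rel \<Rightarrow> 'a set \<Rightarrow> real fps" where
  "rev_chrom E U = Abs_fps (\<lambda>k. if k \<le> card U then coeff (chrom E U) (card U - k) else 0)"

lemma rev_chrom_nth_0: "irrefl E \<Longrightarrow> finite U \<Longrightarrow> rev_chrom E U $ 0 = 1"
  by (simp add: rev_chrom_def coeff_chrom_card)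

text \<open>The missing power of the variable brings all induced subgraphs to the common degree
  \<open>m\<close>, so that polynomial identities transfer coefficient by coefficient.\<close>

lemma shifted_rev_chrom_nth:
  assumes "finite U" "card U \<le> m"
  shows "(fps_X ^ (m - card U) * rev_chrom E U) $ k = (if k \<le> m then coeff (chrom E U) (m - k) else 0)"
proof (cases "k < m - card U")
  case True
  then have "degree (chrom E U) < m - k"
    using degree_chrom_le[OF assms(1), of E] by linarith
  then show ?thesis using True by (auto simp: fps_X_power_mult_nth coeff_eq_0)
next
  case False
  moreover have "k \<le> m \<Longrightarrow> card U - (k - (m - card U)) = m - k"
    using False assms(2) by linarith
  moreover have "k - (m - card U) \<le> card U \<longleftrightarrow> k \<le> m" using False assms(2) by linarith
  ultimately show ?thesis by (auto simp: fps_X_power_mult_nth rev_chrom_def)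
qed

text \<open>The polymer expansion divided by \<open>q^(card M + 1)\<close>: of the remaining
  \<open>q^(-card M)\<close>, the part \<open>q^(-card B)\<close> stays outside
  \<open>rev_chrom E (M - B)\<close>.\<close>

lemma rev_chrom_insert:
  assumes "finite M" "x \<notin> M"
  shows "rev_chrom E (insert x M)
    = (\<Sum>B\<in>Pow M. fps_const (ursell E (insert x B)) * (fps_X ^ card B * rev_chrom E (M - B)))"
proof (rule fps_ext)
  fix k
  let ?m = "card M"
  have "(fps_X ^ card B * rev_chrom E (M - B)) $ k = (if k \<le> ?m then coeff (chrom E (M - B)) (?m - k) else 0)"
    if "B \<in> Pow M" for B
  proof -
    have B: "finite B" "card B \<le> ?m" using that assms(1) finite_subset by (auto intro: card_mono)
    then have "card (M - B) = ?m - card B" using that by (auto intro: card_Diff_subset)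
    then show ?thesis using shifted_rev_chrom_nth[of "M - B" ?m E k] B assms(1) by simp
  qed
  then have "(\<Sum>B\<in>Pow M. fps_const (ursell E (insert x B)) * (fps_X ^ card B * rev_chrom E (M - B))) $ k
    = (if k \<le> ?m then \<Sum>B\<in>Pow M. ursell E (insert x B) * coeff (chrom E (M - B)) (?m - k) else 0)"
    by (simp add: fps_sum_nth)
  also have "\<dots> = rev_chrom E (insert x M) $ k"
  proof (cases "k \<le> ?m")
    case True
    then have "Suc ?m - k = Suc (?m - k)" by simp
    then show ?thesis
      using True assms by (simp add: rev_chrom_def chrom_insert_ursell coeff_sum)
  next
    case False
    then have "k = Suc ?m \<or> Suc ?m < k" by linarith
    then show ?thesis using assms by (auto simp: rev_chrom_def chrom_insert_ursell)
  qed
  finally show "rev_chrom E (insert x M) $ k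
    = (\<Sum>B\<in>Pow M. fps_const (ursell E (insert x B)) * (fps_X ^ card B * rev_chrom E (M - B))) $ k" by simp
qed

lemma fps_X_mult_deriv_nth: "(fps_X * fps_deriv f) $ k = of_nat k * (f $ k :: real)"
  by (cases k) (simp_all add: fps_X_mult_nth)

text \<open>With \<open>R(z) = z^m P(1/z)\<close> one has
  \<open>m R - z R' = z^(m-1) P'(1/z)\<close>, so this is \<open>pderiv_chrom\<close> at
  \<open>1/z\<close> multiplied by \<open>z^m\<close>.\<close>

lemma rev_chrom_deriv:
  assumes "finite U"
  shows "fps_X * (fps_const (real (card U)) * rev_chrom E U - fps_X * fps_deriv (rev_chrom E U))
    = (\<Sum>S\<in>Pow U. fps_const (ursell E S) * (fps_X ^ card S * rev_chrom E (U - S)))"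
proof (rule fps_ext)
  fix k
  let ?m = "card U"
  have "(fps_X ^ card S * rev_chrom E (U - S)) $ k = (if k \<le> ?m then coeff (chrom E (U - S)) (?m - k) else 0)"
    if "S \<in> Pow U" for S
  proof -
    have S: "finite S" "card S \<le> ?m" using that assms(1) finite_subset by (auto intro: card_mono)
    then have "card (U - S) = ?m - card S" using that by (auto intro: card_Diff_subset)
    then show ?thesis using shifted_rev_chrom_nth[of "U - S" ?m E k] S assms(1) by simp
  qed
  then have "(\<Sum>S\<in>Pow U. fps_const (ursell E S) * (fps_X ^ card S * rev_chrom E (U - S))) $ k
    = (if k \<le> ?m then \<Sum>S\<in>Pow U. ursell E S * coeff (chrom E (U - S)) (?m - k) else 0)"
    by (simp add: fps_sum_nth)
  also have "\<dots> = (if k \<le> ?m then real (Suc (?m - k)) * coeff (chrom E U) (Suc (?m - k)) else 0)"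
    using coeff_pderiv[of "chrom E U" "?m - k"] by (simp add: pderiv_chrom[OF assms] coeff_sum)
  also have "\<dots> = (fps_X * (fps_const (real ?m) * rev_chrom E U - fps_X * fps_deriv (rev_chrom E U))) $ k"
  proof (cases k)
    case 0
    have "degree (chrom E U) < Suc ?m" using degree_chrom_le[OF assms, of E] by simp
    then show ?thesis by (simp add: 0 coeff_eq_0)
  next
    case (Suc j)
    have "(if Suc j \<le> ?m then real (Suc (?m - Suc j)) * coeff (chrom E U) (Suc (?m - Suc j)) else 0)
        = (real ?m - real j) * rev_chrom E U $ j"
    proof (cases "Suc j \<le> ?m")
      case True
      then have "Suc (?m - Suc j) = ?m - j" by simp
      then show ?thesis using True by (simp add: rev_chrom_def of_nat_diff del: of_nat_Suc)
    next
      case False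
      then have "j = ?m \<or> ?m < j" by linarith
      then show ?thesis using False by (auto simp: rev_chrom_def)
    qed
    moreover have "(fps_X * (fps_const (real ?m) * rev_chrom E U - fps_X * fps_deriv (rev_chrom E U))) $ Suc j
        = (real ?m - real j) * rev_chrom E U $ j"
    proof -
      define D where "D = fps_X * fps_deriv (rev_chrom E U)"
      have "D $ j = real j * rev_chrom E U $ j" unfolding D_def by (rule fps_X_mult_deriv_nth)
      then show ?thesis unfolding D_def[symmetric] by (simp add: left_diff_distrib)
    qed
    ultimately show ?thesis unfolding Suc by simp
  qed
  finally show "(fps_X * (fps_const (real ?m) * rev_chrom E U - fps_X * fps_deriv (rev_chrom E U))) $ k
    = (\<Sum>S\<in>Pow U. fps_const (ursell E S) * (fps_X ^ card S * rev_chrom E (U - S))) $ k" by simp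
qed

section \<open>Correlation functions and the logarithmic derivative\<close>

definition rho :: "'a rel \<Rightarrow> 'a set \<Rightarrow> 'a set \<Rightarrow> real fps" where
  "rho E U X = rev_chrom E (U - X) * inverse (rev_chrom E U)"

lemma rev_chrom_inverse: "irrefl E \<Longrightarrow> finite U \<Longrightarrow> rev_chrom E U * inverse (rev_chrom E U) = 1"
  by (simp add: inverse_mult_eq_1' rev_chrom_nth_0)

lemma rho_empty: "irrefl E \<Longrightarrow> finite U \<Longrightarrow> rho E U {} = 1"
  by (simp add: rho_def rev_chrom_inverse)

text \<open>The polymer expansion rooted at \<open>x\<close> in \<open>U - Y\<close>, divided by
  \<open>rev_chrom E U\<close>. Its term for \<open>B = {}\<close> is
  \<open>rho E U (insert x Y)\<close> itself; all others carry a power of \<open>fps_X\<close>.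
  Hence coefficient \<open>k\<close> is determined by lower coefficients and by the smaller set
  \<open>Y\<close>.\<close>

lemma rho_insert:
  assumes "irrefl E" "finite U" "insert x Y \<subseteq> U" "x \<notin> Y"
  shows "rho E U (insert x Y) $ k = rho E U Y $ k - (\<Sum>B\<in>Pow (U - insert x Y).
    if B = {} \<or> k < card B then 0 else ursell E (insert x B) * rho E U (insert x Y \<union> B) $ (k - card B))"
proof -
  let ?M = "U - insert x Y"
  have fin: "finite ?M" using assms(2) by simp
  have UY: "U - Y = insert x ?M" using assms(3,4) by auto
  have "rho E U Y = (\<Sum>B\<in>Pow ?M. fps_const (ursell E (insert x B)) * (fps_X ^ card B * rev_chrom E (?M - B)))
      * inverse (rev_chrom E U)"
    unfolding rho_def UY by (subst rev_chrom_insert) (use fin in auto)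
  also have "\<dots> = (\<Sum>B\<in>Pow ?M. fps_const (ursell E (insert x B)) * (fps_X ^ card B * rho E U (insert x Y \<union> B)))"
    by (simp add: rho_def sum_distrib_right mult.assoc Diff_Un set_diff_eq) 
  finally have "rho E U Y $ k
      = (\<Sum>B\<in>Pow ?M. ursell E (insert x B) * (if k < card B then 0 else rho E U (insert x Y \<union> B) $ (k - card B)))"
    by (simp add: fps_sum_nth fps_X_power_mult_nth del: Un_insert_left)
  also have "\<dots> = (\<Sum>B\<in>Pow ?M. (if B = {} then rho E U (insert x Y) $ k else 0) +
     (if B = {} \<or> k < card B then 0 else ursell E (insert x B) * rho E U (insert x Y \<union> B) $ (k - card B)))"
    using assms(1) by (intro sum.cong refl) (auto simp: ursell_singleton irrefl_def)
  also have "\<dots> = rho E U (insert x Y) $ k + (\<Sum>B\<in>Pow ?M.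
     if B = {} \<or> k < card B then 0 else ursell E (insert x B) * rho E U (insert x Y \<union> B) $ (k - card B))"
    using fin by (simp add: sum.distrib sum.delta)
  finally show ?thesis by simp
qed

definition log_deriv :: "'a rel \<Rightarrow> 'a set \<Rightarrow> real fps" where
  "log_deriv E U = fps_X * fps_deriv (rev_chrom E U) * inverse (rev_chrom E U)"

text \<open>This is \<open>rev_chrom_deriv\<close> divided by \<open>rev_chrom E U\<close>. The
  outer factor \<open>fps_X\<close> shifts the index to \<open>Suc k\<close>, and for
  \<open>k > 0\<close> the constant \<open>card U\<close> drops out.\<close>

lemma log_deriv_nth:
  assumes "irrefl E" "finite U" "k > 0"
  shows "log_deriv E U $ k
    = - (\<Sum>S\<in>Pow U. if Suc k < card S then 0 else ursell E S * rho E U S $ (Suc k - card S))"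
proof -
  have "fps_X * (fps_const (real (card U)) - log_deriv E U)
      = fps_X * (fps_const (real (card U)) * rev_chrom E U - fps_X * fps_deriv (rev_chrom E U))
        * inverse (rev_chrom E U)"
    using rev_chrom_inverse[OF assms(1,2)] by (simp add: log_deriv_def algebra_simps)
  also have "\<dots> = (\<Sum>S\<in>Pow U. fps_const (ursell E S) * (fps_X ^ card S * rho E U S))"
    by (simp add: rev_chrom_deriv[OF assms(2)] rho_def sum_distrib_right mult.assoc)
  finally have "(fps_X * (fps_const (real (card U)) - log_deriv E U)) $ Suc k
    = (\<Sum>S\<in>Pow U. if Suc k < card S then 0 else ursell E S * rho E U S $ (Suc k - card S))"
    by (simp add: fps_sum_nth fps_X_power_mult_nth if_distrib cong: if_cong)
  then show ?thesis using assms(3) by simp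
qed

section \<open>Majorant bounds\<close>

lemma sum_fact_card_le:
  assumes "finite M" "card M \<le> n" "n > 0"
  shows "(\<Sum>B\<in>Pow M. fact (card B) * (1 / (4 * real n)) ^ card B) \<le> 4 / 3"
proof -
  let ?m = "card M"
  have "(\<Sum>B\<in>Pow M. fact (card B) * (1 / (4 * real n)) ^ card B)
      = (\<Sum>j\<le>?m. real (?m choose j) * (fact j * (1 / (4 * real n)) ^ j))"
    by (rule sum_Pow_card[OF assms(1)])
  also have "\<dots> \<le> (\<Sum>j\<le>?m. (1 / 4) ^ j)"
  proof (intro sum_mono)
    fix j
    \<comment> \<open>There are at most \<open>?m ^ j / j!\<close> subsets of size \<open>j\<close>,
      so the factorials cancel and a geometric series of ratio \<open>1/4\<close> remains.\<close>
    have "(?m choose j) * fact j \<le> ?m ^ j" by (rule binomial_fact_pow)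
    also have "\<dots> \<le> n ^ j" using assms(2) by (rule power_mono) simp
    finally have "real ((?m choose j) * fact j) \<le> real (n ^ j)" by (rule of_nat_mono)
    then have "real (?m choose j) * fact j * (1 / (4 * real n)) ^ j \<le> real n ^ j * (1 / (4 * real n)) ^ j"
      by (intro mult_right_mono) auto
    also have "\<dots> = (1 / 4) ^ j" using assms(3) by (simp flip: power_mult_distrib)
    finally show "real (?m choose j) * (fact j * (1 / (4 * real n)) ^ j) \<le> (1 / 4) ^ j" by (simp add: mult.assoc)
  qed
  also have "\<dots> \<le> (\<Sum>j. (1 / 4) ^ j)"
    by (rule sum_le_suminf) (auto intro: summable_geometric)
  also have "\<dots> = 4 / 3" by (subst suminf_geometric) auto
  finally show ?thesis .
qed

lemma sum_shifted_powers:
  fixes f :: "nat \<Rightarrow> real"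
  shows "(\<Sum>k\<le>K. (if k < b then 0 else f (k - b)) * t ^ k) = (if b \<le> K then t ^ b * (\<Sum>i\<le>K - b. f i * t ^ i) else 0)"
proof (cases "b \<le> K")
  case True
  have "(\<Sum>k\<le>K. (if k < b then 0 else f (k - b)) * t ^ k) = (\<Sum>k\<in>{b..K}. f (k - b) * t ^ k)"
    by (rule sum.mono_neutral_cong_right) auto
  also have "\<dots> = (\<Sum>i\<le>K - b. f i * t ^ (i + b))"
    by (rule sum.reindex_bij_witness[of _ "\<lambda>i. i + b" "\<lambda>k. k - b"]) (use True in auto)
  finally show ?thesis using True by (simp add: sum_distrib_left power_add mult_ac)
qed (auto intro!: sum.neutral)

text \<open>
  The constants: with \<open>t = 1/(6n)\<close> and \<open>a = 3/2\<close> one has \<open>ta = 1/(4n)\<close>, so the nonempty sets \<open>B\<close> in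
  \<open>rho_insert\<close> contribute at most a factor \<open>\<Sum>\<^bsub>j\<ge>1\<^esub> 4\<^bsup>-j\<^esup> = 1/3\<close>, and \<open>1 + a/3 = a\<close> closes the induction.
\<close>

lemma rho_sum_le:
  fixes E :: "'a rel"
  assumes "irrefl E" "finite U" "U \<noteq> {}" "X \<subseteq> U"
  shows "(\<Sum>k\<le>K. \<bar>rho E U X $ k\<bar> * (1 / (6 * real (card U))) ^ k) \<le> (3 / 2) ^ card X"
  using assms(4)
proof (induction K arbitrary: X rule: less_induct)
  case (less K)
  define n where "n = card U"
  define t where "t = 1 / (6 * real n)"
  have n: "n > 0" using assms(2,3) by (auto simp: n_def card_gt_0_iff)
  have t: "t > 0" using n by (simp add: t_def)
  have "finite X" using less.prems assms(2) finite_subset by blast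
  \<comment> \<open>Peeling off \<open>x\<close> keeps \<open>K\<close> and shrinks the set; adding
    a nonempty \<open>B\<close> enlarges the set but lowers \<open>K\<close>. Hence an induction on
    the set inside the induction on \<open>K\<close>.\<close>
  then have "(\<Sum>k\<le>K. \<bar>rho E U X $ k\<bar> * t ^ k) \<le> (3 / 2) ^ card X"
    using less.prems
  proof (induction X rule: finite_induct)
    case empty
    have "(\<Sum>k\<le>K. \<bar>rho E U {} $ k\<bar> * t ^ k) = (\<Sum>k\<in>{0}. \<bar>rho E U {} $ k\<bar> * t ^ k)"
      using assms by (intro sum.mono_neutral_right) (auto simp: rho_empty)
    then show ?case using assms by (simp add: rho_empty)
  next
    case (insert x Y)
    let ?X = "insert x Y"
    let ?M = "U - ?X"
    let ?s = "(3 / 2) ^ card ?X :: real"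
    let ?w = "\<lambda>B. fact (card B) * (1 / (4 * real n)) ^ card B :: real"
    have fin: "finite ?M" using assms(2) by simp
    have step: "\<bar>rho E U ?X $ k\<bar> * t ^ k \<le> \<bar>rho E U Y $ k\<bar> * t ^ k + (\<Sum>B\<in>Pow ?M - {{}}.
        \<bar>ursell E (insert x B)\<bar> * ((if k < card B then 0 else \<bar>rho E U (?X \<union> B) $ (k - card B)\<bar>) * t ^ k))" for k
    proof -
      let ?g = "\<lambda>B. if B = {} \<or> k < card B then 0 else ursell E (insert x B) * rho E U (?X \<union> B) $ (k - card B)"
      have "\<bar>rho E U ?X $ k\<bar> \<le> \<bar>rho E U Y $ k\<bar> + \<bar>\<Sum>B\<in>Pow ?M. ?g B\<bar>"
        using rho_insert[OF assms(1,2) insert.prems insert.hyps(2)] by simp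
      also have "\<bar>\<Sum>B\<in>Pow ?M. ?g B\<bar> \<le> (\<Sum>B\<in>Pow ?M. \<bar>?g B\<bar>)" by (rule sum_abs)
      also have "\<dots> = (\<Sum>B\<in>Pow ?M - {{}}.
          \<bar>ursell E (insert x B)\<bar> * (if k < card B then 0 else \<bar>rho E U (?X \<union> B) $ (k - card B)\<bar>))"
        using fin by (intro sum.mono_neutral_cong_right) (auto simp: abs_mult)
      finally have "\<bar>rho E U ?X $ k\<bar> * t ^ k \<le> (\<bar>rho E U Y $ k\<bar> + (\<Sum>B\<in>Pow ?M - {{}}.
          \<bar>ursell E (insert x B)\<bar> * (if k < card B then 0 else \<bar>rho E U (?X \<union> B) $ (k - card B)\<bar>))) * t ^ k"
        using t by (intro mult_right_mono) auto
      then show ?thesis by (simp only: distrib_right sum_distrib_right mult.assoc)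
    qed
    have inner: "\<bar>ursell E (insert x B)\<bar> *
        (\<Sum>k\<le>K. (if k < card B then 0 else \<bar>rho E U (?X \<union> B) $ (k - card B)\<bar>) * t ^ k) \<le> ?s * ?w B"
      if B: "B \<in> Pow ?M - {{}}" for B
    proof -
      have fB: "finite B" "x \<notin> B" using B fin finite_subset by auto
      have b: "card B > 0" using B fB by (auto simp: card_gt_0_iff)
      have cX: "card (?X \<union> B) = card ?X + card B"
        using B fB insert.hyps by (intro card_Un_disjoint) auto
      have "(\<Sum>k\<le>K. (if k < card B then 0 else \<bar>rho E U (?X \<union> B) $ (k - card B)\<bar>) * t ^ k)
          \<le> t ^ card B * (3 / 2) ^ (card ?X + card B)"
      proof (cases "card B \<le> K")
        case True
        have "(\<Sum>i\<le>K - card B. \<bar>rho E U (?X \<union> B) $ i\<bar> * t ^ i) \<le> (3 / 2) ^ card (?X \<union> B)"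
          unfolding t_def n_def using True b B insert.prems by (intro less.IH) auto
        then show ?thesis
          using True t unfolding cX by (subst sum_shifted_powers) (auto intro: mult_left_mono)
      qed (use t in \<open>auto simp: sum_shifted_powers\<close>)
      then have "\<bar>ursell E (insert x B)\<bar> *
          (\<Sum>k\<le>K. (if k < card B then 0 else \<bar>rho E U (?X \<union> B) $ (k - card B)\<bar>) * t ^ k)
        \<le> fact (card B) * (t ^ card B * (3 / 2) ^ (card ?X + card B))"
        using abs_ursell_insert_le[OF assms(1) fB] t by (intro mult_mono) (auto intro!: sum_nonneg)
      also have "\<dots> = ?s * (fact (card B) * (t * (3 / 2)) ^ card B)"
        by (simp only: power_add power_mult_distrib mult_ac)
      also have "t * (3 / 2) = 1 / (4 * real n)" by (simp add: t_def)
      finally show ?thesis .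
    qed
    have "(\<Sum>k\<le>K. \<bar>rho E U ?X $ k\<bar> * t ^ k) \<le> (\<Sum>k\<le>K. \<bar>rho E U Y $ k\<bar> * t ^ k) + (\<Sum>k\<le>K. \<Sum>B\<in>Pow ?M - {{}}.
        \<bar>ursell E (insert x B)\<bar> * ((if k < card B then 0 else \<bar>rho E U (?X \<union> B) $ (k - card B)\<bar>) * t ^ k))"
      unfolding sum.distrib[symmetric] by (intro sum_mono step)
    also have "(\<Sum>k\<le>K. \<Sum>B\<in>Pow ?M - {{}}.
        \<bar>ursell E (insert x B)\<bar> * ((if k < card B then 0 else \<bar>rho E U (?X \<union> B) $ (k - card B)\<bar>) * t ^ k))
      = (\<Sum>B\<in>Pow ?M - {{}}. \<bar>ursell E (insert x B)\<bar> *
        (\<Sum>k\<le>K. (if k < card B then 0 else \<bar>rho E U (?X \<union> B) $ (k - card B)\<bar>) * t ^ k))"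
      by (subst sum.swap) (simp only: sum_distrib_left)
    also have "\<dots> \<le> (\<Sum>B\<in>Pow ?M - {{}}. ?s * ?w B)" by (intro sum_mono inner)
    also have "\<dots> = ?s * ((\<Sum>B\<in>Pow ?M. ?w B) - 1)"
      using fin by (simp add: sum_distrib_left[symmetric] sum_diff1)
    also have "\<dots> \<le> ?s * (1 / 3)"
    proof -
      have "card ?M \<le> n" unfolding n_def using assms(2) by (intro card_mono) auto
      then have "(\<Sum>B\<in>Pow ?M. ?w B) \<le> 4 / 3" using sum_fact_card_le[OF fin _ n] by blast
      then show ?thesis by (intro mult_left_mono) auto
    qed
    also have "(\<Sum>k\<le>K. \<bar>rho E U Y $ k\<bar> * t ^ k) \<le> (3 / 2) ^ card Y"
      using insert by simp
    finally show ?case using insert.hyps by simp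
  qed
  then show ?case by (simp add: t_def n_def)
qed

text \<open>Scaled by \<open>t ^ Suc k\<close>, the term of a nonempty \<open>S\<close> is at most
  \<open>(card S)! (4n)^(-card S)\<close>, and these sum to at most \<open>4/3 - 1 = 1/3\<close>.
  Undoing the scaling gives \<open>(6n)^(k+1) / 3 = 2n (6n)^k\<close>.\<close>

lemma log_deriv_bound:
  assumes "irrefl E" "finite U" "U \<noteq> {}" "k > 0"
  shows "\<bar>log_deriv E U $ k\<bar> \<le> 2 * real (card U) * (6 * real (card U)) ^ k"
proof -
  define n where "n = card U"
  define t where "t = 1 / (6 * real n)"
  have n: "n > 0" using assms(2,3) by (auto simp: n_def card_gt_0_iff)
  have t: "t > 0" using n by (simp add: t_def)
  let ?g = "\<lambda>S. if Suc k < card S then 0 else ursell E S * rho E U S $ (Suc k - card S)"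
  let ?w = "\<lambda>B. fact (card B) * (1 / (4 * real n)) ^ card B :: real"
  have "\<bar>?g S\<bar> * t ^ Suc k \<le> ?w S" if S: "S \<in> Pow U - {{}}" for S
  proof (cases "card S \<le> Suc k")
    case True
    obtain x B where xB: "S = insert x B" "x \<notin> B" using S by (metis Set.set_insert DiffE ex_in_conv singletonI)
    have fB: "finite B" using xB S assms(2) finite_subset by fastforce
    have "\<bar>ursell E S\<bar> \<le> fact (card B)" unfolding xB using abs_ursell_insert_le[OF assms(1) fB xB(2)] .
    also have "\<dots> \<le> fact (card S)" using xB fB by (intro fact_mono) auto
    finally have u: "\<bar>ursell E S\<bar> \<le> fact (card S)" .
    let ?j = "Suc k - card S"
    have "\<bar>rho E U S $ ?j\<bar> * t ^ ?j \<le> (\<Sum>k\<le>?j. \<bar>rho E U S $ k\<bar> * t ^ k)"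
      using t by (intro member_le_sum) auto
    also have "\<dots> \<le> (3 / 2) ^ card S"
      unfolding t_def n_def using S by (intro rho_sum_le assms) auto
    finally have r: "\<bar>rho E U S $ ?j\<bar> * t ^ ?j \<le> (3 / 2) ^ card S" .
    have "t ^ Suc k = t ^ ?j * t ^ card S" using True by (simp flip: power_add)
    then have "\<bar>?g S\<bar> * t ^ Suc k = \<bar>ursell E S\<bar> * (\<bar>rho E U S $ ?j\<bar> * t ^ ?j) * t ^ card S"
      using True by (simp add: abs_mult)
    also have "\<dots> \<le> fact (card S) * (3 / 2) ^ card S * t ^ card S"
      using u r t by (intro mult_right_mono mult_mono) auto
    also have "\<dots> = fact (card S) * (3 / 2 * t) ^ card S" by (simp only: power_mult_distrib mult.assoc)
    also have "3 / 2 * t = 1 / (4 * real n)" by (simp add: t_def)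
    finally show ?thesis .
  qed simp
  note term_le = this
  have "\<bar>log_deriv E U $ k\<bar> * t ^ Suc k \<le> (\<Sum>S\<in>Pow U. \<bar>?g S\<bar>) * t ^ Suc k"
    unfolding log_deriv_nth[OF assms(1,2,4)] using t by (intro mult_right_mono) (auto intro: sum_abs simp del: power_Suc)
  also have "\<dots> = (\<Sum>S\<in>Pow U - {{}}. \<bar>?g S\<bar> * t ^ Suc k)"
    unfolding sum_distrib_right using assms(2) by (intro sum.mono_neutral_right) auto
  also have "\<dots> \<le> (\<Sum>S\<in>Pow U - {{}}. ?w S)" by (intro sum_mono term_le)
  also have "\<dots> = (\<Sum>S\<in>Pow U. ?w S) - 1" using assms(2) by (simp add: sum_diff1)
  also have "\<dots> \<le> 1 / 3" using sum_fact_card_le[OF assms(2) _ n] by (simp add: n_def)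
  finally have "\<bar>log_deriv E U $ k\<bar> * t ^ Suc k \<le> 1 / 3" .
  moreover have "t ^ Suc k = 1 / (6 * real n) ^ Suc k" by (simp add: t_def power_divide)
  ultimately have "\<bar>log_deriv E U $ k\<bar> \<le> 1 / 3 * (6 * real n) ^ Suc k"
    using n by (simp add: pos_divide_le_eq del: power_Suc)
  then show ?thesis by (simp add: n_def mult_ac)
qed

section \<open>Locality of the coefficients\<close>

text \<open>One function \<open>l\<close> serves all \<open>U\<close>: the ambient set matters only
  through the small sets it contains.\<close>

definition local_at :: "'a set \<Rightarrow> nat \<Rightarrow> ('a set \<Rightarrow> real) \<Rightarrow> ('a set \<Rightarrow> real) \<Rightarrow> bool" where
  "local_at X d f l \<longleftrightarrow> (\<forall>Y. d < card Y \<longrightarrow> l Y = 0) \<and>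
     (\<forall>U. finite U \<longrightarrow> X \<subseteq> U \<longrightarrow> f U = (\<Sum>Y\<in>Pow (U - X). l Y))"

text \<open>Induction along \<open>rho_insert\<close>. A polymer \<open>B\<close> together with a
  set of size at most \<open>k - card B\<close>, contributed by a lower coefficient, is again a set
  of size at most \<open>k\<close>.\<close>

lemma rho_local:
  assumes "irrefl E" "finite X"
  shows "\<exists>l. local_at X k (\<lambda>U. rho E U X $ k) l"
  using assms(2)
proof (induction k arbitrary: X rule: less_induct)
  case (less k)
  from less.prems show ?case
  proof (induction X rule: finite_induct)
    case empty
    let ?l = "\<lambda>Y::'a set. if Y = {} then (1::real fps) $ k else 0"
    have "local_at {} k (\<lambda>U. rho E U {} $ k) ?l"
      using assms(1) by (auto simp: local_at_def rho_empty sum.delta)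
    then show ?case by blast
  next
    case (insert x Y0)
    let ?X = "insert x Y0"
    obtain l1 where l1: "local_at Y0 k (\<lambda>U. rho E U Y0 $ k) l1" using insert.IH by blast
    have "\<exists>l. local_at (?X \<union> B) (k - card B) (\<lambda>U. rho E U (?X \<union> B) $ (k - card B)) l"
      if "finite B" "B \<noteq> {}" "card B \<le> k" for B
    proof -
      have "card B > 0" using that by (simp add: card_gt_0_iff)
      then show ?thesis using that insert.hyps by (intro less.IH) auto
    qed
    then obtain l2 where l2: "\<And>B. finite B \<Longrightarrow> B \<noteq> {} \<Longrightarrow> card B \<le> k \<Longrightarrow>
        local_at (?X \<union> B) (k - card B) (\<lambda>U. rho E U (?X \<union> B) $ (k - card B)) (l2 B)"
      by metis
    let ?c = "\<lambda>B. if B = {} \<or> k < card B then 0 else ursell E (insert x B)"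
    \<comment> \<open>A set counted for \<open>Y0\<close> may or may not contain \<open>x\<close>,
      whence two values of \<open>l1\<close>; the sum collects the ways to split \<open>Y\<close>
      into a polymer \<open>B\<close> and a set disjoint from it.\<close>
    let ?l = "\<lambda>Y. l1 Y + l1 (insert x Y) - (\<Sum>B\<in>Pow Y. ?c B * l2 B (Y - B))"
    have "?l Y = 0" if Y: "k < card Y" for Y
    proof -
      have fY: "finite Y" using Y card.infinite by fastforce
      have "card Y \<le> card (insert x Y)" using fY by (intro card_mono) auto
      then have l1_0: "l1 Y = 0" "l1 (insert x Y) = 0" using l1 Y by (auto simp: local_at_def)
      have "?c B * l2 B (Y - B) = 0" if B: "B \<in> Pow Y" for B
      proof (cases "B = {} \<or> k < card B")
        case False
        have "finite B" using B fY finite_subset by auto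
        moreover from this have "card (Y - B) = card Y - card B" using B by (intro card_Diff_subset) auto
        ultimately show ?thesis using l2[of B] False Y by (auto simp: local_at_def)
      qed simp
      then have "(\<Sum>B\<in>Pow Y. ?c B * l2 B (Y - B)) = 0" by (intro sum.neutral) blast
      then show ?thesis using l1_0 by simp
    qed
    moreover have "rho E U ?X $ k = (\<Sum>Y\<in>Pow (U - ?X). ?l Y)" if U: "finite U" "?X \<subseteq> U" for U
    proof -
      let ?M = "U - ?X"
      have fin: "finite ?M" using U by simp
      have UY: "U - Y0 = insert x ?M" using U insert.hyps by auto
      have "rho E U Y0 $ k = (\<Sum>Y\<in>Pow ?M. l1 Y) + (\<Sum>Y\<in>Pow ?M. l1 (insert x Y))"
      proof -
        have "rho E U Y0 $ k = (\<Sum>Y\<in>Pow (U - Y0). l1 Y)" using l1 U by (simp add: local_at_def)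
        then show ?thesis unfolding UY by (subst (asm) sum_Pow_insert[OF fin]) auto
      qed
      moreover have "(\<Sum>B\<in>Pow ?M. if B = {} \<or> k < card B then 0
          else ursell E (insert x B) * rho E U (?X \<union> B) $ (k - card B))
        = (\<Sum>B\<in>Pow ?M. \<Sum>Y\<in>Pow (?M - B). ?c B * l2 B Y)"
      proof (intro sum.cong refl)
        fix B assume B: "B \<in> Pow ?M"
        show "(if B = {} \<or> k < card B then 0
          else ursell E (insert x B) * rho E U (?X \<union> B) $ (k - card B)) = (\<Sum>Y\<in>Pow (?M - B). ?c B * l2 B Y)"
        proof (cases "B = {} \<or> k < card B")
          case False
          have "finite B" using B fin finite_subset by auto
          then have "local_at (?X \<union> B) (k - card B) (\<lambda>U. rho E U (?X \<union> B) $ (k - card B)) (l2 B)"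
            using l2 False by auto
          moreover have "U - (?X \<union> B) = ?M - B" "?X \<union> B \<subseteq> U" using B U by auto
          ultimately have "rho E U (?X \<union> B) $ (k - card B) = (\<Sum>Y\<in>Pow (?M - B). l2 B Y)"
            using U(1) unfolding local_at_def by metis
          then show ?thesis using False by (simp add: sum_distrib_left)
        qed simp
      qed
      ultimately show ?thesis
        unfolding rho_insert[OF assms(1) U insert.hyps(2)]
        by (simp add: sum_Pow_Diff_regroup[OF fin] sum.distrib sum_subtractf)
    qed
    ultimately have "local_at ?X k (\<lambda>U. rho E U ?X $ k) ?l" by (simp add: local_at_def)
    then show ?case by blast
  qed
qed

text \<open>As for \<open>rho\<close>: the union of \<open>S\<close> with a set of size at most
  \<open>Suc k - card S\<close> has at most \<open>Suc k\<close> elements.\<close>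

lemma log_deriv_local:
  assumes "irrefl E" "k > 0"
  shows "\<exists>l. local_at {} (Suc k) (\<lambda>U. log_deriv E U $ k) l"
proof -
  have "\<exists>l. local_at S (Suc k - card S) (\<lambda>U. rho E U S $ (Suc k - card S)) l" if "finite S" for S
    using rho_local[OF assms(1) that] .
  then obtain l2 where l2: "\<And>S. finite S \<Longrightarrow> local_at S (Suc k - card S) (\<lambda>U. rho E U S $ (Suc k - card S)) (l2 S)"
    by metis
  let ?c = "\<lambda>S. if Suc k < card S then 0 else ursell E S"
  let ?l = "\<lambda>W. - (\<Sum>S\<in>Pow W. ?c S * l2 S (W - S))"
  have "?l W = 0" if W: "Suc k < card W" for W
  proof -
    have fW: "finite W" using W card.infinite by fastforce
    have "?c S * l2 S (W - S) = 0" if S: "S \<in> Pow W" for S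
    proof (cases "Suc k < card S")
      case False
      have "finite S" using S fW finite_subset by auto
      moreover from this have "card (W - S) = card W - card S" using S by (intro card_Diff_subset) auto
      ultimately show ?thesis using l2[of S] False W by (auto simp: local_at_def)
    qed simp
    then have "(\<Sum>S\<in>Pow W. ?c S * l2 S (W - S)) = 0" by (intro sum.neutral) blast
    then show ?thesis by simp
  qed
  moreover have "log_deriv E U $ k = (\<Sum>W\<in>Pow U. ?l W)" if U: "finite U" for U
  proof -
    have "(\<Sum>S\<in>Pow U. if Suc k < card S then 0 else ursell E S * rho E U S $ (Suc k - card S))
      = (\<Sum>S\<in>Pow U. \<Sum>Y\<in>Pow (U - S). ?c S * l2 S Y)"
    proof (intro sum.cong refl)
      fix S assume S: "S \<in> Pow U"
      then have "finite S" using U finite_subset by auto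
      then have "rho E U S $ (Suc k - card S) = (\<Sum>Y\<in>Pow (U - S). l2 S Y)"
        using l2[of S] S U by (simp add: local_at_def)
      then show "(if Suc k < card S then 0 else ursell E S * rho E U S $ (Suc k - card S))
        = (\<Sum>Y\<in>Pow (U - S). ?c S * l2 S Y)" by (simp add: sum_distrib_left)
    qed
    then show ?thesis
      by (simp add: log_deriv_nth[OF assms(1) U assms(2)] sum_Pow_Diff_regroup[OF U] sum_negf)
  qed
  ultimately have "local_at {} (Suc k) (\<lambda>U. log_deriv E U $ k) ?l" by (simp add: local_at_def)
  then show ?thesis by blast
qed

section \<open>Invariance under isomorphism\<close>

lemma chrom_image:
  assumes "finite U" "inj_on f U" "\<And>u v. u \<in> U \<Longrightarrow> v \<in> U \<Longrightarrow> (f u, f v) \<in> E' \<longleftrightarrow> (u, v) \<in> E"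
  shows "chrom E' (f ` U) = chrom E U"
  using assms
proof (induction "card U" arbitrary: U rule: less_induct)
  case less
  show ?case
  proof (cases "U = {}")
    case False
    then obtain x N where xN: "U = insert x N" "x \<notin> N" by (metis Set.set_insert ex_in_conv)
    have fin: "finite N" using less.prems xN by simp
    have fx: "f x \<notin> f ` N" using less.prems(2) xN by auto
    have injN: "inj_on f N" using less.prems(2) xN by auto
    have inj_im: "inj_on ((`) f) (Pow N)" using injN by (rule inj_on_image_Pow)
    have W: "stable_ind E' (insert (f x) (f ` W)) = stable_ind E (insert x W)"
      "chrom E' (f ` N - f ` W) = chrom E (N - W)" if "W \<in> Pow N" for W
    proof -
      have "(f u, f v) \<in> E' \<longleftrightarrow> (u, v) \<in> E" if "u \<in> insert x W" "v \<in> insert x W" for u v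
        using that \<open>W \<in> Pow N\<close> xN(1) by (intro less.prems(3)) auto
      then have "stable_set E' (f ` insert x W) = stable_set E (insert x W)"
        unfolding stable_set_def by blast
      then show "stable_ind E' (insert (f x) (f ` W)) = stable_ind E (insert x W)"
        by (simp add: stable_ind_def)
      have eq: "f ` N - f ` W = f ` (N - W)"
        using that injN by (subst inj_on_image_set_diff[OF injN]) auto
      have "card (N - W) < card U" using fin xN by (simp add: card_mono less_Suc_eq_le)
      then show "chrom E' (f ` N - f ` W) = chrom E (N - W)"
        unfolding eq using fin injN less.prems(3) xN(1)
        by (intro less.hyps) (auto intro: inj_on_subset)
    qed
    \<comment> \<open>Instead of transporting partitions, the recursion at \<open>f x\<close> is
      matched term by term with the recursion at \<open>x\<close>.\<close>
    have "poly (chrom E' (f ` U)) q = poly (chrom E U) q" for q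
    proof -
      have "poly (chrom E' (f ` U)) q = q * (\<Sum>W\<in>(`) f ` Pow N.
          stable_ind E' (insert (f x) W) * poly (chrom E' (f ` N - W)) (q - 1))"
        using poly_chrom_insert[of "f ` N" "f x" E' q] fin fx by (simp add: xN(1) image_Pow_surj[OF refl])
      also have "\<dots> = q * (\<Sum>W\<in>Pow N. stable_ind E (insert x W) * poly (chrom E (N - W)) (q - 1))"
        using W by (simp add: sum.reindex[OF inj_im])
      finally show ?thesis by (simp add: xN(1) poly_chrom_insert[OF fin xN(2)])
    qed
    then show ?thesis by (rule poly_eqI_all)
  qed simp
qed

lemma log_deriv_image:
  assumes "finite U" "inj_on f U" "\<And>u v. u \<in> U \<Longrightarrow> v \<in> U \<Longrightarrow> (f u, f v) \<in> E' \<longleftrightarrow> (u, v) \<in> E"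
  shows "log_deriv E' (f ` U) = log_deriv E U"
proof -
  have "chrom E' (f ` U) = chrom E U" using assms by (rule chrom_image)
  then have "rev_chrom E' (f ` U) = rev_chrom E U"
    by (simp add: rev_chrom_def card_image[OF assms(2)] cong: if_cong)
  then show ?thesis by (simp add: log_deriv_def)
qed

text \<open>The Moebius inverse of \<open>log_deriv\<close> on the subset lattice. The local
  contributions are so far only known to exist; an explicit formula makes their isomorphism
  invariance visible.\<close>

definition log_deriv_mob :: "nat \<Rightarrow> 'a rel \<Rightarrow> 'a set \<Rightarrow> real" where
  "log_deriv_mob k E W = (\<Sum>T\<in>Pow W. (-1) ^ (card W - card T) * log_deriv E T $ k)"

lemma log_deriv_mob_image:
  assumes "finite W" "inj_on f W" "\<And>u v. u \<in> W \<Longrightarrow> v \<in> W \<Longrightarrow> (f u, f v) \<in> E' \<longleftrightarrow> (u, v) \<in> E"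
  shows "log_deriv_mob k E' (f ` W) = log_deriv_mob k E W"
proof -
  have inj_im: "inj_on ((`) f) (Pow W)" using assms(2) by (rule inj_on_image_Pow)
  have "log_deriv E' (f ` T) = log_deriv E T" "card (f ` T) = card T" if "T \<in> Pow W" for T
  proof -
    have T: "finite T" "inj_on f T"
      using that assms(1) finite_subset inj_on_subset[OF assms(2)] by auto
    show "log_deriv E' (f ` T) = log_deriv E T"
      using T that assms(3) by (intro log_deriv_image) (auto simp: subset_iff)
    show "card (f ` T) = card T" using T(2) by (rule card_image)
  qed
  then show ?thesis
    using card_image[OF assms(2)]
    by (simp add: log_deriv_mob_def image_Pow_surj[OF refl, symmetric] sum.reindex[OF inj_im])
qed

text \<open>Moebius inversion identifies the contributions of \<open>log_deriv_local\<close> with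
  \<open>log_deriv_mob\<close>, which therefore vanishes above size \<open>Suc k\<close>.\<close>

lemma log_deriv_eq_sum_mob:
  assumes "irrefl E" "finite U" "k > 0"
  shows "log_deriv E U $ k = (\<Sum>j\<le>Suc k. \<Sum>W | W \<subseteq> U \<and> card W = j. log_deriv_mob k E W)"
proof -
  obtain l where l: "local_at {} (Suc k) (\<lambda>U. log_deriv E U $ k) l"
    using log_deriv_local[OF assms(1,3)] by blast
  have "l W = log_deriv_mob k E W" if "finite W" for W
    unfolding log_deriv_mob_def
    by (rule inclusion_exclusion_mobius[OF _ that]) (use l in \<open>simp add: local_at_def\<close>)
  then have eq: "log_deriv E U $ k = (\<Sum>W\<in>Pow U. log_deriv_mob k E W)"
    and zero: "\<And>W. W \<in> Pow U \<Longrightarrow> Suc k < card W \<Longrightarrow> log_deriv_mob k E W = 0"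
    using l assms(2) finite_subset[OF _ assms(2)] by (auto simp: local_at_def)
  have "log_deriv E U $ k = (\<Sum>W\<in>{W\<in>Pow U. card W \<le> Suc k}. log_deriv_mob k E W)"
    unfolding eq using assms(2) zero by (intro sum.mono_neutral_right) (auto simp: not_le)
  also have "\<dots> = (\<Sum>j\<le>Suc k. \<Sum>W | W \<in> {W\<in>Pow U. card W \<le> Suc k} \<and> card W = j. log_deriv_mob k E W)"
    using assms(2) by (intro sum.group[symmetric]) auto
  also have "\<dots> = (\<Sum>j\<le>Suc k. \<Sum>W | W \<subseteq> U \<and> card W = j. log_deriv_mob k E W)"
    by (intro sum.cong refl) auto
  finally show ?thesis .
qed

section \<open>Convergence of the coefficients\<close>

text \<open>Each \<open>j\<close>-set is the image of \<open>j!\<close> injective labellings.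
  Labelled sums can be compared with homomorphism counts.\<close>

lemma sum_subsets_eq_sum_inj:
  fixes g :: "'a set \<Rightarrow> real"
  assumes "finite V"
  shows "(\<Sum>z\<in>{z\<in>{..<j} \<rightarrow>\<^sub>E V. inj_on z {..<j}}. g (z ` {..<j})) = fact j * (\<Sum>W | W \<subseteq> V \<and> card W = j. g W)"
proof -
  let ?Z = "{z\<in>{..<j} \<rightarrow>\<^sub>E V. inj_on z {..<j}}"
  have fib: "real (card {z\<in>?Z. z ` {..<j} = W}) = fact j" if W: "W \<subseteq> V" "card W = j" for W
  proof -
    have "finite W" using W assms finite_subset by blast
    then have "{z\<in>?Z. z ` {..<j} = W} = {z\<in>{..<j} \<rightarrow>\<^sub>E W. inj_on z {..<j}}"
    proof -
      have "z ` {..<j} = W" if "z \<in> {..<j} \<rightarrow>\<^sub>E W" "inj_on z {..<j}" for z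
        using that W(2) \<open>finite W\<close> by (intro card_subset_eq) (auto simp: card_image)
      then show ?thesis using W by auto
    qed
    then have "card {z\<in>?Z. z ` {..<j} = W} = (\<Prod>i=0..<j. j - i)"
      using card_inj_on_subset_funcset[of "{..<j}" W] \<open>finite W\<close> W by simp
    then show ?thesis by (simp add: fact_prod_rev)
  qed
  have "(\<Sum>W | W \<subseteq> V \<and> card W = j. \<Sum>z | z \<in> ?Z \<and> z ` {..<j} = W. g (z ` {..<j})) = (\<Sum>z\<in>?Z. g (z ` {..<j}))"
  proof (rule sum.group)
    have "finite ({..<j} \<rightarrow>\<^sub>E V)" using assms by (intro finite_PiE) auto
    then show "finite ?Z" by simp
    have "finite (Pow V)" using assms by simp
    then show "finite {W. W \<subseteq> V \<and> card W = j}" by (rule finite_subset[rotated]) auto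
    show "(\<lambda>z. z ` {..<j}) ` ?Z \<subseteq> {W. W \<subseteq> V \<and> card W = j}"
    proof (intro subsetI)
      fix W assume "W \<in> (\<lambda>z. z ` {..<j}) ` ?Z"
      then obtain z where z: "W = z ` {..<j}" "z \<in> {..<j} \<rightarrow>\<^sub>E V" "inj_on z {..<j}" by blast
      have "card W = j" unfolding z(1) card_image[OF z(3)] by simp
      moreover have "W \<subseteq> V" unfolding z(1) using PiE_mem[OF z(2)] by (rule image_subsetI)
      ultimately show "W \<in> {W. W \<subseteq> V \<and> card W = j}" by simp
    qed
  qed
  moreover have "(\<Sum>z | z \<in> ?Z \<and> z ` {..<j} = W. g (z ` {..<j})) = fact j * g W" if "W \<subseteq> V" "card W = j" for W
  proof -
    have "(\<Sum>z | z \<in> ?Z \<and> z ` {..<j} = W. g (z ` {..<j})) = (\<Sum>z | z \<in> ?Z \<and> z ` {..<j} = W. g W)"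
      by (intro sum.cong refl) blast
    then show ?thesis unfolding sum_constant fib[OF that] .
  qed
  ultimately show ?thesis unfolding sum_distrib_left by (metis (mono_tags, lifting) mem_Collect_eq sum.cong)
qed

text \<open>The pattern of arcs seen by the labelling \<open>z\<close>. Labels are natural numbers
  because the vertices of the test graphs are.\<close>

definition pullback :: "(nat \<Rightarrow> 'a) \<Rightarrow> nat \<Rightarrow> 'a rel \<Rightarrow> nat rel" where
  "pullback z j E = {(a, b). a < j \<and> b < j \<and> (z a, z b) \<in> E}"

text \<open>Index \<open>0\<close> is exempt because the shape and order of the graphs are only
  assumed from index \<open>1\<close> on.\<close>

lemma convergent_eventually_eq:
  assumes "convergent f" "\<And>n. n \<ge> 1 \<Longrightarrow> f n = (g n :: real)"
  shows "convergent g"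
proof -
  have "\<forall>\<^sub>F n in sequentially. f n = g n"
    using assms(2) by (auto simp: eventually_sequentially)
  then show ?thesis
    using assms(1) unfolding convergent_def by (metis Lim_transform_eventually)
qed

text \<open>The product counts the injections of a \<open>j\<close>-set into an
  \<open>n\<close>-set, so asymptotically almost all maps are injective.\<close>

lemma tendsto_inj_fraction:
  "(\<lambda>n. real (\<Prod>i=0..<j. n - i) / real n ^ j) \<longlonglongrightarrow> 1"
proof -
  have "(\<lambda>n. real (n - i) / real n) \<longlonglongrightarrow> 1" for i
  proof (rule Lim_transform_eventually)
    show "(\<lambda>n. 1 - real i / real n) \<longlonglongrightarrow> 1"
      using tendsto_diff[OF tendsto_const lim_const_over_n[of "real i"], of 1] by simp
    show "\<forall>\<^sub>F n in sequentially. 1 - real i / real n = real (n - i) / real n"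
      using eventually_ge_at_top[of "max 1 i"]
      by eventually_elim (simp add: of_nat_diff diff_divide_distrib)
  qed
  then have "(\<lambda>n. \<Prod>i=0..<j. real (n - i) / real n) \<longlonglongrightarrow> (\<Prod>i=0..<j. 1)"
    by (intro tendsto_prod)
  then show ?thesis by (simp add: prod_dividef)
qed

text \<open>Moebius inversion writes an arbitrary function of a pattern as a combination of the
  indicators of \<open>Q \<subseteq> R\<close>, which homomorphism counts can measure.\<close>

lemma subset_sum_expansion:
  fixes \<Psi> :: "'a set \<Rightarrow> real"
  obtains h where "\<And>R. finite R \<Longrightarrow> \<Psi> R = (\<Sum>Q\<in>Pow R. h Q)"
proof
  fix R :: "'a set" assume "finite R"
  then show "\<Psi> R = (\<Sum>Q\<in>Pow R. (-1) ^ card Q * (\<Sum>T\<in>Pow Q. (-1) ^ card T * \<Psi> T))"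
    by (intro inclusion_exclusion_symmetric[of _ \<Psi>]) auto
qed

section \<open>Averages along a dense convergent sequence\<close>

locale convergent_graph_sequence =
  fixes G :: "nat \<Rightarrow> 'a pair_pre_digraph"
  assumes graph: "\<And>n. n \<ge> 1 \<Longrightarrow> pair_graph (G n)"
    and order: "\<And>n. n \<ge> 1 \<Longrightarrow> card (pverts (G n)) = n"
    and dense: "dense_convergent G"
begin

lemma finite_verts: "n \<ge> 1 \<Longrightarrow> finite (pverts (G n))"
  using order[of n] card.infinite by fastforce

lemma irrefl_arcs: "n \<ge> 1 \<Longrightarrow> irrefl (parcs (G n))"
  using pair_loopfree_digraph.no_loops'[of "G n"] graph[of n]
  by (auto simp: irrefl_def pair_graph_def pair_digraph_def)

lemma sym_arcs: "n \<ge> 1 \<Longrightarrow> (u, v) \<in> parcs (G n) \<Longrightarrow> (v, u) \<in> parcs (G n)"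
  using pair_sym_digraph.arcs_symmetric[of "G n"] graph[of n]
  by (auto simp: pair_graph_def pair_pseudo_graph_def)

lemma convergent_pattern_count:
  assumes "Q \<subseteq> {..<j} \<times> {..<j}"
  shows "convergent (\<lambda>n. real (card {z\<in>{..<j} \<rightarrow>\<^sub>E pverts (G n). Q \<subseteq> pullback z j (parcs (G n))}) / real n ^ j)"
proof (cases "irrefl Q")
  case True
  \<comment> \<open>Symmetrising a loop-free \<open>Q\<close> gives a test graph. As the arcs of
    \<open>G n\<close> are symmetric, the maps whose pattern contains \<open>Q\<close> are exactly
    its homomorphisms.\<close>
  define F where "F = \<lparr>pverts = {..<j}, parcs = Q \<union> Q\<inverse>\<rparr>"
  have "pair_graph F"
    using assms True finite_subset[OF assms]
    by unfold_locales (auto simp: F_def irrefl_def symmetric_def sym_def)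
  then have "convergent (\<lambda>n. hom_density F (G n))"
    using dense by (simp add: dense_convergent_def)
  then show ?thesis
  proof (rule convergent_eventually_eq)
    fix n :: nat assume n: "n \<ge> 1"
    have "(\<forall>(u, v)\<in>parcs F. (z u, z v) \<in> parcs (G n)) \<longleftrightarrow> Q \<subseteq> pullback z j (parcs (G n))" for z
      using assms sym_arcs[OF n] by (fastforce simp: F_def pullback_def)
    then show "hom_density F (G n)
      = real (card {z\<in>{..<j} \<rightarrow>\<^sub>E pverts (G n). Q \<subseteq> pullback z j (parcs (G n))}) / real n ^ j"
      using order[OF n] by (simp add: hom_density_def hom_count_def F_def)
  qed
next
  case False
  \<comment> \<open>A loop in \<open>Q\<close> cannot be mapped into the loop-free
    \<open>G n\<close>, so the count is zero.\<close>
  then obtain a where a: "(a, a) \<in> Q" by (auto simp: irrefl_def)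
  show ?thesis
  proof (rule convergent_eventually_eq[OF convergent_const[of 0]])
    fix n :: nat assume n: "n \<ge> 1"
    have "{z\<in>{..<j} \<rightarrow>\<^sub>E pverts (G n). Q \<subseteq> pullback z j (parcs (G n))} = {}"
      using a irrefl_arcs[OF n] by (auto simp: pullback_def irrefl_def)
    then show "0 = real (card {z\<in>{..<j} \<rightarrow>\<^sub>E pverts (G n). Q \<subseteq> pullback z j (parcs (G n))}) / real n ^ j"
      by (simp only: card.empty of_nat_0 div_0)
  qed
qed

text \<open>By \<open>subset_sum_expansion\<close> the average is a finite combination of pattern
  counts with coefficients independent of \<open>n\<close>.\<close>

lemma convergent_pattern_average:
  fixes \<Psi> :: "nat rel \<Rightarrow> real"
  shows "convergent (\<lambda>n. (\<Sum>z\<in>{..<j} \<rightarrow>\<^sub>E pverts (G n). \<Psi> (pullback z j (parcs (G n)))) / real n ^ j)"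
proof -
  let ?D = "{..<j} \<times> {..<j}"
  obtain h where h: "\<And>R. finite R \<Longrightarrow> \<Psi> R = (\<Sum>Q\<in>Pow R. h Q)"
    using subset_sum_expansion[of \<Psi>] by blast
  have "convergent (\<lambda>n. \<Sum>Q\<in>Pow ?D. h Q *
      (real (card {z\<in>{..<j} \<rightarrow>\<^sub>E pverts (G n). Q \<subseteq> pullback z j (parcs (G n))}) / real n ^ j))"
    by (intro convergent_sum convergent_mult convergent_const convergent_pattern_count) auto
  then show ?thesis
  proof (rule convergent_eventually_eq)
    fix n :: nat assume n: "n \<ge> 1"
    let ?Z = "{..<j} \<rightarrow>\<^sub>E pverts (G n)"
    let ?p = "\<lambda>z. pullback z j (parcs (G n))"
    have finZ: "finite ?Z" using finite_verts[OF n] by (intro finite_PiE) auto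
    have sub: "?p z \<subseteq> ?D" for z by (auto simp: pullback_def)
    have "(\<Sum>z\<in>?Z. \<Psi> (?p z)) = (\<Sum>z\<in>?Z. \<Sum>Q\<in>Pow ?D. if Q \<subseteq> ?p z then h Q else 0)"
    proof (intro sum.cong refl)
      fix z
      have "finite (?p z)" using sub finite_subset by (metis finite_SigmaI finite_lessThan)
      then have "\<Psi> (?p z) = (\<Sum>Q\<in>Pow (?p z). h Q)" by (rule h)
      also have "\<dots> = (\<Sum>Q\<in>Pow ?D. if Q \<subseteq> ?p z then h Q else 0)"
        using sub[of z] by (intro sum.mono_neutral_cong_left) auto
      finally show "\<Psi> (?p z) = (\<Sum>Q\<in>Pow ?D. if Q \<subseteq> ?p z then h Q else 0)" .
    qed
    also have "\<dots> = (\<Sum>Q\<in>Pow ?D. \<Sum>z\<in>?Z. if Q \<subseteq> ?p z then h Q else 0)" by (rule sum.swap)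
    also have "\<dots> = (\<Sum>Q\<in>Pow ?D. h Q * real (card {z\<in>?Z. Q \<subseteq> ?p z}))"
      using finZ by (intro sum.cong refl) (simp add: sum.inter_filter[symmetric])
    finally show "(\<Sum>Q\<in>Pow ?D. h Q * (real (card {z\<in>?Z. Q \<subseteq> ?p z}) / real n ^ j))
        = (\<Sum>z\<in>?Z. \<Psi> (?p z)) / real n ^ j"
      by (simp add: sum_divide_distrib)
  qed
qed

text \<open>Noninjective maps are a vanishing fraction of all \<open>n ^ j\<close> maps and
  \<open>\<Psi>\<close> is bounded on the finitely many patterns on \<open>{..<j}\<close>, so
  dropping them preserves convergence.\<close>

lemma convergent_inj_pattern_average:
  fixes \<Psi> :: "nat rel \<Rightarrow> real"
  shows "convergent (\<lambda>n. (\<Sum>z\<in>{z\<in>{..<j} \<rightarrow>\<^sub>E pverts (G n). inj_on z {..<j}}.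
    \<Psi> (pullback z j (parcs (G n)))) / real n ^ j)"
proof -
  let ?D = "{..<j} \<times> {..<j}"
  let ?Z = "\<lambda>n. {..<j} \<rightarrow>\<^sub>E pverts (G n)"
  let ?I = "\<lambda>n. {z\<in>?Z n. inj_on z {..<j}}"
  let ?f = "\<lambda>n z. \<Psi> (pullback z j (parcs (G n)))"
  define B where "B = (\<Sum>R\<in>Pow ?D. \<bar>\<Psi> R\<bar>)"
  have B: "\<bar>?f n z\<bar> \<le> B" for n z
    unfolding B_def by (rule member_le_sum) (auto simp: pullback_def)
  have "(\<lambda>n. (\<Sum>z\<in>?Z n - ?I n. ?f n z) / real n ^ j) \<longlonglongrightarrow> 0"
  proof (rule Lim_null_comparison)
    show "(\<lambda>n. B * (1 - real (\<Prod>i=0..<j. n - i) / real n ^ j)) \<longlonglongrightarrow> 0"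
      using tendsto_mult[OF tendsto_const[of B] tendsto_diff[OF tendsto_const[of 1] tendsto_inj_fraction[of j]]]
      by simp
    show "\<forall>\<^sub>F n in sequentially. norm ((\<Sum>z\<in>?Z n - ?I n. ?f n z) / real n ^ j)
        \<le> B * (1 - real (\<Prod>i=0..<j. n - i) / real n ^ j)"
      using eventually_ge_at_top[of 1]
    proof eventually_elim
      case (elim n)
      have fin: "finite (?Z n)" using finite_verts[OF elim] by (intro finite_PiE) auto
      have cI: "card (?I n) = (\<Prod>i=0..<j. n - i)"
        using card_inj_on_subset_funcset[of "{..<j}" "pverts (G n)"] finite_verts[OF elim] order[OF elim] by simp
      have cZ: "card (?Z n) = n ^ j" using order[OF elim] by (simp add: card_funcsetE)
      have "\<bar>\<Sum>z\<in>?Z n - ?I n. ?f n z\<bar> \<le> (\<Sum>z\<in>?Z n - ?I n. B)"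
        by (intro order.trans[OF sum_abs] sum_mono B)
      also have "\<dots> = B * (real (card (?Z n)) - real (card (?I n)))"
      proof -
        have "card (?Z n - ?I n) = card (?Z n) - card (?I n)" "card (?I n) \<le> card (?Z n)"
          using fin by (auto intro: card_Diff_subset card_mono)
        then show ?thesis by (simp add: of_nat_diff)
      qed
      finally have "\<bar>\<Sum>z\<in>?Z n - ?I n. ?f n z\<bar> / real n ^ j
          \<le> B * (real n ^ j - real (\<Prod>i=0..<j. n - i)) / real n ^ j"
        unfolding cI cZ by (intro divide_right_mono) auto
      also have "\<dots> = B * (1 - real (\<Prod>i=0..<j. n - i) / real n ^ j)"
        using elim by (simp add: diff_divide_distrib right_diff_distrib)
      finally show ?case by simp
    qed
  qed
  then have "convergent (\<lambda>n. (\<Sum>z\<in>?Z n. ?f n z) / real n ^ j - (\<Sum>z\<in>?Z n - ?I n. ?f n z) / real n ^ j)"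
    by (intro convergent_diff convergent_pattern_average) (auto simp: convergent_def)
  then show ?thesis
  proof (rule convergent_eventually_eq)
    fix n :: nat assume n: "n \<ge> 1"
    have fin: "finite (?Z n)" using finite_verts[OF n] by (intro finite_PiE) auto
    then have "(\<Sum>z\<in>?Z n - ?I n. ?f n z) = (\<Sum>z\<in>?Z n. ?f n z) - (\<Sum>z\<in>?I n. ?f n z)"
      by (intro sum_diff) auto
    then show "(\<Sum>z\<in>?Z n. ?f n z) / real n ^ j - (\<Sum>z\<in>?Z n - ?I n. ?f n z) / real n ^ j
        = (\<Sum>z\<in>?I n. ?f n z) / real n ^ j"
      by (simp add: diff_divide_distrib)
  qed
qed

lemma convergent_log_deriv:
  assumes "k > 0"
  shows "convergent (\<lambda>n. log_deriv (parcs (G n)) (pverts (G n)) $ k / real n ^ Suc k)"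
proof -
  let ?I = "\<lambda>j n. {z\<in>{..<j} \<rightarrow>\<^sub>E pverts (G n). inj_on z {..<j}}"
  \<comment> \<open>There are at most \<open>n ^ j / j!\<close> sets of size \<open>j\<close>, which
    leaves \<open>Suc k - j\<close> spare factors \<open>1/n\<close>; only \<open>j = Suc k\<close>
    can contribute to the limit.\<close>
  have "convergent (\<lambda>n. \<Sum>j\<le>Suc k. (1 / fact j) * ((\<Sum>z\<in>?I j n.
      log_deriv_mob k (pullback z j (parcs (G n))) {..<j}) / real n ^ j) * (1 / real n) ^ (Suc k - j))"
  proof (intro convergent_sum convergent_mult convergent_const)
    fix j
    show "convergent (\<lambda>n. (\<Sum>z\<in>?I j n. log_deriv_mob k (pullback z j (parcs (G n))) {..<j}) / real n ^ j)"
      by (rule convergent_inj_pattern_average[of "\<lambda>R. log_deriv_mob k R {..<j}"])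
    show "convergent (\<lambda>n. (1 / real n) ^ (Suc k - j))"
      using tendsto_power[OF lim_const_over_n[of "1::real"]] by (auto simp: convergent_def)
  qed
  then show ?thesis
  proof (rule convergent_eventually_eq)
    fix n :: nat assume n: "n \<ge> 1"
    let ?E = "parcs (G n)" and ?V = "pverts (G n)"
    have sum_eq: "(\<Sum>z\<in>?I j n. log_deriv_mob k (pullback z j ?E) {..<j})
        = fact j * (\<Sum>W | W \<subseteq> ?V \<and> card W = j. log_deriv_mob k ?E W)" for j
    proof -
      have "log_deriv_mob k (pullback z j ?E) {..<j} = log_deriv_mob k ?E (z ` {..<j})" if "z \<in> ?I j n" for z
        using that by (intro log_deriv_mob_image[symmetric]) (auto simp: pullback_def)
      then show ?thesis
        unfolding sum_subsets_eq_sum_inj[OF finite_verts[OF n], symmetric] by (intro sum.cong refl) auto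
    qed
    have "(\<Sum>j\<le>Suc k. (1 / fact j) * ((\<Sum>z\<in>?I j n. log_deriv_mob k (pullback z j ?E) {..<j}) / real n ^ j)
          * (1 / real n) ^ (Suc k - j))
      = (\<Sum>j\<le>Suc k. (\<Sum>W | W \<subseteq> ?V \<and> card W = j. log_deriv_mob k ?E W) / real n ^ Suc k)"
    proof (intro sum.cong refl)
      fix j assume "j \<in> {..Suc k}"
      then have "real n ^ Suc k = real n ^ j * real n ^ (Suc k - j)" by (simp flip: power_add)
      then show "(1 / fact j) * ((\<Sum>z\<in>?I j n. log_deriv_mob k (pullback z j ?E) {..<j}) / real n ^ j)
          * (1 / real n) ^ (Suc k - j) = (\<Sum>W | W \<subseteq> ?V \<and> card W = j. log_deriv_mob k ?E W) / real n ^ Suc k"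
        unfolding sum_eq by (simp add: power_divide)
    qed
    also have "\<dots> = log_deriv ?E ?V $ k / real n ^ Suc k"
      by (simp only: log_deriv_eq_sum_mob[OF irrefl_arcs[OF n] finite_verts[OF n] assms] sum_divide_distrib)
    finally show "(\<Sum>j\<le>Suc k. (1 / fact j) * ((\<Sum>z\<in>?I j n. log_deriv_mob k (pullback z j ?E) {..<j}) / real n ^ j)
          * (1 / real n) ^ (Suc k - j)) = log_deriv ?E ?V $ k / real n ^ Suc k" .
  qed
qed

end

section \<open>Convergence of the logarithm\<close>

lemma degree_chrom: "irrefl E \<Longrightarrow> finite U \<Longrightarrow> degree (chrom E U) = card U"
  using degree_chrom_le[of U E] coeff_chrom_card[of E U] le_degree[of "chrom E U" "card U"] by simp

lemma rev_chrom_eq_reflect_poly: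
  assumes "irrefl E" "finite U"
  shows "rev_chrom E U = fps_of_poly (reflect_poly (chrom E U))"
  by (rule fps_ext) (auto simp: rev_chrom_def coeff_reflect_poly degree_chrom[OF assms])

lemma poly_reflect_chrom:
  assumes "irrefl E" "finite U" "q \<noteq> 0"
  shows "poly (chrom E U) q = q ^ card U * poly (reflect_poly (chrom E U)) (1 / q)"
  using assms(3) poly_reflect_poly_nz[of "1 / q" "chrom E U"] degree_chrom[OF assms(1,2)]
  by (simp add: field_simps)

text \<open>The formal logarithm, from \<open>z L' = log_deriv\<close>. At \<open>k = 0\<close>
  division by zero gives \<open>0\<close>, the logarithm of the constant term \<open>1\<close> of
  \<open>rev_chrom\<close>.\<close>

definition log_rev_chrom :: "'a rel \<Rightarrow> 'a set \<Rightarrow> real fps" where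
  "log_rev_chrom E U = Abs_fps (\<lambda>k. log_deriv E U $ k / real k)"

lemma fps_deriv_log_rev_chrom:
  "fps_deriv (log_rev_chrom E U) = fps_deriv (rev_chrom E U) * inverse (rev_chrom E U)"
  by (rule fps_ext) (simp add: log_rev_chrom_def log_deriv_def mult.assoc)

lemma log_rev_chrom_bound:
  assumes "irrefl E" "finite U" "U \<noteq> {}"
  shows "\<bar>log_rev_chrom E U $ k\<bar> \<le> 2 * real (card U) * (6 * real (card U)) ^ k"
proof (cases "k = 0")
  case False
  have "\<bar>log_rev_chrom E U $ k\<bar> \<le> \<bar>log_deriv E U $ k\<bar>"
    using False by (simp add: log_rev_chrom_def divide_le_eq mult_left_mono[of 1 "real k" "\<bar>log_deriv E U $ k\<bar>", simplified])
  then show ?thesis using log_deriv_bound[OF assms, of k] False by simp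
qed (simp add: log_rev_chrom_def)

lemma conv_radius_log_rev_chrom:
  assumes "irrefl E" "finite U" "U \<noteq> {}"
  shows "fps_conv_radius (log_rev_chrom E U) \<ge> ereal (1 / (6 * real (card U)))"
  unfolding fps_conv_radius_def
proof (rule conv_radius_geI_ex)
  let ?n = "real (card U)"
  have n: "?n > 0" using assms(2,3) by (simp add: card_gt_0_iff)
  fix r :: real assume r: "0 < r" "ereal r < ereal (1 / (6 * ?n))"
  then have lt: "6 * ?n * r < 1" using n by (simp add: field_simps)
  have "summable (\<lambda>k. 2 * ?n * (6 * ?n * r) ^ k)"
    using lt n r by (intro summable_mult summable_geometric) (simp add: abs_mult)
  then have "summable (\<lambda>k. log_rev_chrom E U $ k * r ^ k)"
  proof (rule summable_comparison_test'[where N = 0])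
    fix k
    have "\<bar>log_rev_chrom E U $ k\<bar> * r ^ k \<le> 2 * ?n * (6 * ?n) ^ k * r ^ k"
      using log_rev_chrom_bound[OF assms] r by (intro mult_right_mono) auto
    then show "norm (log_rev_chrom E U $ k * r ^ k) \<le> 2 * ?n * (6 * ?n * r) ^ k"
      using r by (simp add: abs_mult power_mult_distrib mult_ac)
  qed
  then show "\<exists>z. norm z = r \<and> summable (\<lambda>k. log_rev_chrom E U $ k * z ^ k)"
    using r by (intro exI[of _ r]) simp
qed

text \<open>With \<open>R\<close> the reflected polynomial and \<open>L\<close> the series,
  \<open>R exp(-L)\<close> has derivative zero since \<open>L' R = R'\<close> holds formally, and it
  equals \<open>1\<close> at \<open>0\<close>. That \<open>R\<close> has no zero in the interval is
  a consequence.\<close>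

lemma poly_reflect_chrom_eq_exp:
  assumes "irrefl E" "finite U" "U \<noteq> {}" "\<bar>z\<bar> < 1 / (6 * real (card U))"
  shows "poly (reflect_poly (chrom E U)) z = exp (eval_fps (log_rev_chrom E U) z)"
proof -
  let ?R = "reflect_poly (chrom E U)"
  let ?L = "log_rev_chrom E U"
  let ?S = "ball (0::real) (1 / (6 * real (card U)))"
  have F: "rev_chrom E U = fps_of_poly ?R" by (rule rev_chrom_eq_reflect_poly[OF assms(1,2)])
  have in_conv: "ereal (norm w) < fps_conv_radius ?L" if "w \<in> ?S" for w
    using that by (intro less_le_trans[OF _ conv_radius_log_rev_chrom[OF assms(1-3)]]) simp
  have "((\<lambda>z. poly ?R z * exp (- eval_fps ?L z)) has_field_derivative 0) (at w within ?S)" if w: "w \<in> ?S" for w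
  proof -
    have "fps_deriv ?L * rev_chrom E U = fps_deriv (rev_chrom E U)"
      using rev_chrom_inverse[OF assms(1,2)] by (simp add: fps_deriv_log_rev_chrom mult_ac)
    then have "eval_fps (fps_deriv ?L * fps_of_poly ?R) w = poly (pderiv ?R) w"
      unfolding F by (simp flip: fps_of_poly_pderiv)
    moreover have "eval_fps (fps_deriv ?L * fps_of_poly ?R) w = eval_fps (fps_deriv ?L) w * poly ?R w"
      using in_conv[OF w] fps_conv_radius_deriv[of ?L] by (subst eval_fps_mult) auto
    ultimately have eq: "poly (pderiv ?R) w = eval_fps (fps_deriv ?L) w * poly ?R w" by simp
    have "(eval_fps ?L has_field_derivative eval_fps (fps_deriv ?L) w) (at w within ?S)"
      using in_conv[OF w] by (intro has_field_derivative_eval_fps) simp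
    moreover have "(poly ?R has_field_derivative poly (pderiv ?R) w) (at w within ?S)"
      by (rule DERIV_subset[OF poly_DERIV]) simp
    ultimately show ?thesis
      by (auto intro!: derivative_eq_intros simp: eq algebra_simps)
  qed
  then obtain c where c: "\<And>w. w \<in> ?S \<Longrightarrow> poly ?R w * exp (- eval_fps ?L w) = c"
    using has_field_derivative_zero_constant[of ?S "\<lambda>z. poly ?R z * exp (- eval_fps ?L z)"] convex_ball by blast
  have "0 \<in> ?S" using assms(2,3) by (simp add: card_gt_0_iff)
  moreover have "poly ?R 0 = 1"
    using rev_chrom_nth_0[OF assms(1,2)] F by (simp add: poly_0_coeff_0)
  moreover have "eval_fps ?L 0 = 0" by (simp add: eval_fps_at_0 log_rev_chrom_def)
  ultimately have "c = 1" using c[of 0] by simp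
  then have "poly ?R z * exp (- eval_fps ?L z) = 1" using c[of z] assms(4) by simp
  then show ?thesis by (simp add: exp_minus field_simps)
qed

lemma chromatic_poly_eq_poly_chrom:
  "chromatic_poly G x = poly (chrom (parcs G) (pverts G)) x"
proof -
  have "{P. partition_on (pverts G) P \<and> card P = k \<and> (\<forall>A\<in>P. independent_set G A)}
      = stable_partitions (parcs G) (pverts G) k" for k
    using partition_onD1 by (fastforce simp: stable_partitions_def stable_set_def independent_set_def)
  then show ?thesis
    by (simp add: chromatic_poly_def ip_def chrom_def poly_sum poly_prod atLeast0AtMost)
qed

section \<open>The limit of the roots\<close>

context convergent_graph_sequence
begin

text \<open>For \<open>C > 6\<close> the point \<open>1 / (C n)\<close> lies within the radius of
  convergence, and \<open>P = (C n)^n exp(L)\<close> is the \<open>n\<close>-th power of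
  \<open>C n exp(L / n)\<close>. The division by \<open>n\<close> goes inside the series to prepare
  for Tannery's theorem.\<close>

lemma root_chromatic_poly:
  assumes "n \<ge> 1" "C > 6"
  shows "root n (chromatic_poly (G n) (C * real n)) / real n = C * exp (\<Sum>k.
    log_rev_chrom (parcs (G n)) (pverts (G n)) $ k * (1 / (C * real n)) ^ k / real n)"
proof -
  let ?E = "parcs (G n)" and ?V = "pverts (G n)"
  let ?L = "log_rev_chrom ?E ?V"
  define z where "z = 1 / (C * real n)"
  define s where "s = (\<Sum>k. ?L $ k * z ^ k / real n)"
  note E = irrefl_arcs[OF assms(1)] and V = finite_verts[OF assms(1)] and card = order[OF assms(1)]
  have ne: "?V \<noteq> {}" using card assms(1) by auto
  have z: "\<bar>z\<bar> < 1 / (6 * real (card ?V))"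
    unfolding card z_def using assms by (simp add: field_simps)
  have "summable (\<lambda>k. ?L $ k * z ^ k)"
    using z by (intro summable_fps less_le_trans[OF _ conv_radius_log_rev_chrom[OF E V ne]]) simp
  then have "s = eval_fps ?L z / real n"
    unfolding s_def eval_fps_def by (rule suminf_divide)
  then have "eval_fps ?L z = real n * s" using assms(1) by simp
  then have "chromatic_poly (G n) (C * real n) = (C * real n) ^ n * exp (real n * s)"
    using poly_reflect_chrom[OF E V, of "C * real n"] poly_reflect_chrom_eq_exp[OF E V ne z] assms card
    by (simp add: chromatic_poly_eq_poly_chrom z_def)
  also have "\<dots> = (C * real n * exp s) ^ n"
    by (simp add: power_mult_distrib exp_of_nat_mult)
  finally have "root n (chromatic_poly (G n) (C * real n)) = C * real n * exp s"
    using assms by (simp add: real_root_power_cancel)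
  then show ?thesis using assms(1) by (simp add: s_def z_def)
qed

theorem convergent_root_chromatic_poly:
  assumes "C > 6"
  shows "convergent (\<lambda>n. root n (chromatic_poly (G n) (C * real n)) / real n)"
proof -
  define a where "a k n = log_rev_chrom (parcs (G n)) (pverts (G n)) $ k * (1 / (C * real n)) ^ k / real n" for k n
  have conv: "convergent (a k)" for k
  proof (cases "k = 0")
    case True
    then have "a k = (\<lambda>_. 0)" by (simp add: a_def log_rev_chrom_def fun_eq_iff)
    then show ?thesis by (simp add: convergent_const)
  next
    case False
    \<comment> \<open>The powers of \<open>n\<close> in \<open>a k n\<close> combine to
      \<open>n ^ Suc k\<close>, the normalisation of \<open>convergent_log_deriv\<close>.\<close>
    have "convergent (\<lambda>n. log_deriv (parcs (G n)) (pverts (G n)) $ k / real n ^ Suc k * (1 / (real k * C ^ k)))"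
      using convergent_log_deriv[of k] False by (intro convergent_mult convergent_const) auto
    then show ?thesis
      by (rule convergent_eventually_eq) (simp add: a_def log_rev_chrom_def power_divide power_mult_distrib mult_ac)
  qed
  then have lim: "a k \<longlonglongrightarrow> lim (a k)" for k by (simp add: convergent_LIMSEQ_iff)
  \<comment> \<open>The bound \<open>2n (6n)^k\<close> times \<open>(C n)^(-k) / n\<close> is free
    of \<open>n\<close> and gives the dominating geometric series.\<close>
  have bound: "norm (a k n) \<le> 2 * (6 / C) ^ k" if n: "n \<ge> 1" for k n
  proof -
    have ne: "pverts (G n) \<noteq> {}" using order[OF n] n by auto
    have "\<bar>log_rev_chrom (parcs (G n)) (pverts (G n)) $ k\<bar> \<le> 2 * real n * (6 * real n) ^ k"
      using log_rev_chrom_bound[OF irrefl_arcs[OF n] finite_verts[OF n] ne] order[OF n] by simp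
    then have "norm (a k n) \<le> 2 * real n * (6 * real n) ^ k * (1 / (C * real n)) ^ k / real n"
      using assms unfolding a_def real_norm_def abs_divide abs_mult abs_of_nat
      by (intro divide_right_mono mult_mono) auto
    also have "\<dots> = 2 * (6 * real n * (1 / (C * real n))) ^ k"
      unfolding power_mult_distrib[of "6 * real n"] using n by simp
    also have "6 * real n * (1 / (C * real n)) = 6 / C" using n by simp
    finally show ?thesis .
  qed
  \<comment> \<open>Tannery's theorem asks for domination eventually in the product filter; here it
    holds for all \<open>k\<close> once \<open>n \<ge> 1\<close>.\<close>
  have "eventually (\<lambda>(k, n). norm (a k n) \<le> 2 * (6 / C) ^ k) (at_top \<times>\<^sub>F sequentially)"
    using eventually_prodI[OF eventually_True eventually_ge_at_top[of "1::nat"]]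
    by (rule eventually_mono) (use bound in auto)
  moreover have "summable (\<lambda>k. 2 * (6 / C) ^ k)"
    using assms by (intro summable_mult summable_geometric) simp
  ultimately have "(\<lambda>n. \<Sum>k. a k n) \<longlonglongrightarrow> (\<Sum>k. lim (a k))"
    using tannerys_theorem[of a "\<lambda>k. lim (a k)" sequentially "\<lambda>k. 2 * (6 / C) ^ k"] lim by simp
  then have "(\<lambda>n. C * exp (\<Sum>k. a k n)) \<longlonglongrightarrow> C * exp (\<Sum>k. lim (a k))"
    by (intro tendsto_mult tendsto_const tendsto_exp)
  then have "convergent (\<lambda>n. C * exp (\<Sum>k. a k n))" by (rule convergentI)
  then show ?thesis
    by (rule convergent_eventually_eq) (use root_chromatic_poly assms in \<open>simp add: a_def\<close>)
qed

end

theorem theorem1p4: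
  fixes G :: "nat \<Rightarrow> 'a pair_pre_digraph" and C :: real
  assumes "\<And>n. n \<ge> 1 \<Longrightarrow> pair_graph (G n)"
    and "\<And>n. n \<ge> 1 \<Longrightarrow> card (pverts (G n)) = n"
    and "dense_convergent G"
    and "C > 8"
  shows "convergent (\<lambda>n. root n (chromatic_poly (G n) (C * real n)) / real n)"
proof -
  interpret convergent_graph_sequence G
    using assms(1-3) by (rule convergent_graph_sequence.intro)
  show ?thesis using assms(4) by (intro convergent_root_chromatic_poly) simp
qed

end
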